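(* Let $\mathcal{C}$ be a premodel category. There is a class of equivalences which, together with the cofibrations and fibrations of $\mathcal{C}$, makes $\mathcal{C}$ into a Fresse right semi-model category if and only if the following conditions hold: (1) $\mathcal{C}$ is a weak model category. (2) Every fibrant object $X$ of $\mathcal{C}$ admits a strong path object, i.e. a factorization of the diagonal map $X \to PX \to X \times X$ in which $PX \to X\times X$ is a fibration and the composite $PX \to X$ of this fibration with the first projection $X\times X\to X$ is an acyclic fibration. (3) $\mathcal{C}$ is core right saturated. When these conditions hold, the class of equivalences is unique. Moreover, $\mathcal{C}$ is then a Spitzweck right semi-model category if and only if it is also left saturated.
   Context: Premodel category: a complete and cocomplete category with two weak factorization systems, (cofibrations, anodyne fibrations) and (anodyne cofibrations, fibrations), such that every anodyne cofibration is a cofibration (equivalently every anodyne fibration is a fibration). An object is cofibrant if the map from the initial object is a cofibration, fibrant if the map to the terminal object is a fibration. An acyclic cofibration is a cofibration with the left lifting property against all fibrations between fibrant objects; an acyclic fibration is a fibration with the right lifting property against all cofibrations between cofibrant objects. A core cofibration is a cofibration with cofibrant domain; a core fibration is a fibration with fibrant target. Weak model category: a premodel category such that (i) every cofibration $A \to X$ from a cofibrant object to a fibrant object has a relative strong cylinder object, i.e. a factorization $X \coprod_A X \to I_A X \to X$ of the codiagonal whose first map is a cofibration and such that the composite $X \to I_A X$ with the first inclusion is an acyclic cofibration; (ii) every fibration $A \to X$ from a cofibrant object to a fibrant object has a relative strong path object, i.e. a factorization $A \to P_X A \to A \times_X A$ of the diagonal whose second map is a fibration and such that the composite $P_X A \to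 A$ with the first projection is an acyclic fibration. Saturation: a premodel category is left saturated if all acyclic cofibrations are anodyne cofibrations; core right saturated if all core acyclic fibrations (acyclic fibrations with fibrant target) are anodyne fibrations. Fresse right semi-model category: a category with limits and colimits and three classes of maps (weak) equivalences, cofibrations, fibrations such that: (1) weak equivalences satisfy 2-out-of-3 and all three classes are stable under retracts; (2) any map with fibrant target can be factored as a cofibration followed by a trivial fibration, and as a trivial cofibration followed by a fibration (trivial (co)fibration = (co)fibration that is an equivalence); (3) given a cofibration $i$ and a core fibration $p$, one of them being an equivalence, $i$ has the left lifting property against $p$; (4) cofibrations are stable under pushout; (5) the terminal object is fibrant. A Spitzweck right semi-model category is a Fresse right semi-model category in which trivial cofibrations and fibrations form a weak factorization system (with no restriction on targets). *)

theory Defs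
  imports Main "HOL-Library.Equipollence"
begin

section \<open>Categories\<close>

record ('o, 'm) cat =
  obj :: "'o set"
  arr :: "'m set"
  src :: "'m \<Rightarrow> 'o"
  tgt :: "'m \<Rightarrow> 'o"
  idn :: "'o \<Rightarrow> 'm"
  cmp :: "'m \<Rightarrow> 'm \<Rightarrow> 'm"  (infixl "\<cdot>\<index>" 70)

definition hom :: "('o, 'm, 'b) cat_scheme \<Rightarrow> 'o \<Rightarrow> 'o \<Rightarrow> 'm set" where
  "hom C A B = {f \<in> arr C. src C f = A \<and> tgt C f = B}"

text \<open>\<open>g \<cdot>\<^bsub>C\<^esub> f\<close> is ``\<open>f\<close> followed by \<open>g\<close>''; its value is unspecified when \<open>f\<close> and \<open>g\<close>
  are not composable.\<close>

locale category =
  fixes C :: "('o, 'm, 'b) cat_scheme" (structure)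
  assumes src_obj: "f \<in> arr C \<Longrightarrow> src C f \<in> obj C"
    and tgt_obj: "f \<in> arr C \<Longrightarrow> tgt C f \<in> obj C"
    and idn_hom: "A \<in> obj C \<Longrightarrow> idn C A \<in> hom C A A"
    and cmp_hom: "\<lbrakk>f \<in> hom C A B; g \<in> hom C B D\<rbrakk> \<Longrightarrow> g \<cdot> f \<in> hom C A D"
    and cmp_idn: "f \<in> hom C A B \<Longrightarrow> f \<cdot> idn C A = f"
    and idn_cmp: "f \<in> hom C A B \<Longrightarrow> idn C B \<cdot> f = f"
    and cmp_assoc: "\<lbrakk>f \<in> hom C A B; g \<in> hom C B D; h \<in> hom C D E\<rbrakk>
      \<Longrightarrow> h \<cdot> (g \<cdot> f) = (h \<cdot> g) \<cdot> f"


section \<open>Limits and colimits\<close>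

definition is_functor ::
  "('i, 'j, 'a) cat_scheme \<Rightarrow> ('o, 'm, 'b) cat_scheme \<Rightarrow> ('i \<Rightarrow> 'o) \<Rightarrow> ('j \<Rightarrow> 'm) \<Rightarrow> bool" where
  "is_functor J C Fo Fm \<longleftrightarrow>
     (\<forall>j\<in>obj J. Fo j \<in> obj C) \<and>
     (\<forall>u\<in>arr J. Fm u \<in> hom C (Fo (src J u)) (Fo (tgt J u))) \<and>
     (\<forall>j\<in>obj J. Fm (idn J j) = idn C (Fo j)) \<and>
     (\<forall>u\<in>arr J. \<forall>v\<in>arr J. tgt J u = src J v \<longrightarrow> Fm (v \<cdot>\<^bsub>J\<^esub> u) = Fm v \<cdot>\<^bsub>C\<^esub> Fm u)"

definition is_cone ::
  "('i, 'j, 'a) cat_scheme \<Rightarrow> ('o, 'm, 'b) cat_scheme \<Rightarrow> ('i \<Rightarrow> 'o) \<Rightarrow> ('j \<Rightarrow> 'm)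
    \<Rightarrow> 'o \<Rightarrow> ('i \<Rightarrow> 'm) \<Rightarrow> bool" where
  "is_cone J C Fo Fm L \<pi> \<longleftrightarrow>
     L \<in> obj C \<and> (\<forall>j\<in>obj J. \<pi> j \<in> hom C L (Fo j)) \<and>
     (\<forall>u\<in>arr J. Fm u \<cdot>\<^bsub>C\<^esub> \<pi> (src J u) = \<pi> (tgt J u))"

definition is_limit ::
  "('i, 'j, 'a) cat_scheme \<Rightarrow> ('o, 'm, 'b) cat_scheme \<Rightarrow> ('i \<Rightarrow> 'o) \<Rightarrow> ('j \<Rightarrow> 'm)
    \<Rightarrow> 'o \<Rightarrow> ('i \<Rightarrow> 'm) \<Rightarrow> bool" where
  "is_limit J C Fo Fm L \<pi> \<longleftrightarrow>
     is_cone J C Fo Fm L \<pi> \<and>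
     (\<forall>M \<mu>. is_cone J C Fo Fm M \<mu> \<longrightarrow>
        (\<exists>!h. h \<in> hom C M L \<and> (\<forall>j\<in>obj J. \<pi> j \<cdot>\<^bsub>C\<^esub> h = \<mu> j)))"

definition is_cocone ::
  "('i, 'j, 'a) cat_scheme \<Rightarrow> ('o, 'm, 'b) cat_scheme \<Rightarrow> ('i \<Rightarrow> 'o) \<Rightarrow> ('j \<Rightarrow> 'm)
    \<Rightarrow> 'o \<Rightarrow> ('i \<Rightarrow> 'm) \<Rightarrow> bool" where
  "is_cocone J C Fo Fm L \<iota> \<longleftrightarrow>
     L \<in> obj C \<and> (\<forall>j\<in>obj J. \<iota> j \<in> hom C (Fo j) L) \<and>
     (\<forall>u\<in>arr J. \<iota> (tgt J u) \<cdot>\<^bsub>C\<^esub> Fm u = \<iota> (src J u))"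

definition is_colimit ::
  "('i, 'j, 'a) cat_scheme \<Rightarrow> ('o, 'm, 'b) cat_scheme \<Rightarrow> ('i \<Rightarrow> 'o) \<Rightarrow> ('j \<Rightarrow> 'm)
    \<Rightarrow> 'o \<Rightarrow> ('i \<Rightarrow> 'm) \<Rightarrow> bool" where
  "is_colimit J C Fo Fm L \<iota> \<longleftrightarrow>
     is_cocone J C Fo Fm L \<iota> \<and>
     (\<forall>M \<mu>. is_cocone J C Fo Fm M \<mu> \<longrightarrow>
        (\<exists>!h. h \<in> hom C L M \<and> (\<forall>j\<in>obj J. h \<cdot>\<^bsub>C\<^esub> \<iota> j = \<mu> j)))"

text \<open>Smallness is relative to a type \<open>'u\<close> that plays the role of the universe of small sets: a
  category is small if it has strictly fewer than \<open>|'u|\<close> arrows (hence also strictly fewer objects).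
  When \<open>'u\<close> is a Grothendieck universe, this is the usual notion. Every small category is
  isomorphic to one whose objects and arrows are elements of \<open>'u\<close>, so it suffices to consider
  diagrams indexed by such categories.\<close>

definition small_cat :: "('u, 'u) cat \<Rightarrow> bool" where
  "small_cat J \<longleftrightarrow> category J \<and> arr J \<prec> (UNIV :: 'u set)"

definition complete_cat :: "'u itself \<Rightarrow> ('o, 'm, 'b) cat_scheme \<Rightarrow> bool" where
  "complete_cat U C \<longleftrightarrow>
     (\<forall>(J :: ('u, 'u) cat) Fo Fm. small_cat J \<and> is_functor J C Fo Fm \<longrightarrow>
        (\<exists>L \<pi>. is_limit J C Fo Fm L \<pi>))"

definition cocomplete_cat :: "'u itself \<Rightarrow> ('o, 'm, 'b) cat_scheme \<Rightarrow> bool" where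
  "cocomplete_cat U C \<longleftrightarrow>
     (\<forall>(J :: ('u, 'u) cat) Fo Fm. small_cat J \<and> is_functor J C Fo Fm \<longrightarrow>
        (\<exists>L \<iota>. is_colimit J C Fo Fm L \<iota>))"

definition is_initial :: "('o, 'm, 'b) cat_scheme \<Rightarrow> 'o \<Rightarrow> bool" where
  "is_initial C Z \<longleftrightarrow> Z \<in> obj C \<and> (\<forall>X\<in>obj C. \<exists>!f. f \<in> hom C Z X)"

definition is_terminal :: "('o, 'm, 'b) cat_scheme \<Rightarrow> 'o \<Rightarrow> bool" where
  "is_terminal C T \<longleftrightarrow> T \<in> obj C \<and> (\<forall>X\<in>obj C. \<exists>!f. f \<in> hom C X T)"

definition is_product ::
  "('o, 'm, 'b) cat_scheme \<Rightarrow> 'o \<Rightarrow> 'o \<Rightarrow> 'o \<Rightarrow> 'm \<Rightarrow> 'm \<Rightarrow> bool" where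
  "is_product C A B P p q \<longleftrightarrow>
     p \<in> hom C P A \<and> q \<in> hom C P B \<and>
     (\<forall>M. \<forall>a\<in>hom C M A. \<forall>b\<in>hom C M B.
        \<exists>!h. h \<in> hom C M P \<and> p \<cdot>\<^bsub>C\<^esub> h = a \<and> q \<cdot>\<^bsub>C\<^esub> h = b)"

definition is_pullback ::
  "('o, 'm, 'b) cat_scheme \<Rightarrow> 'm \<Rightarrow> 'm \<Rightarrow> 'o \<Rightarrow> 'm \<Rightarrow> 'm \<Rightarrow> bool" where
  "is_pullback C f g P p q \<longleftrightarrow>
     f \<in> arr C \<and> g \<in> arr C \<and> tgt C f = tgt C g \<and>
     p \<in> hom C P (src C f) \<and> q \<in> hom C P (src C g) \<and> f \<cdot>\<^bsub>C\<^esub> p = g \<cdot>\<^bsub>C\<^esub> q \<and>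
     (\<forall>M. \<forall>a\<in>hom C M (src C f). \<forall>b\<in>hom C M (src C g). f \<cdot>\<^bsub>C\<^esub> a = g \<cdot>\<^bsub>C\<^esub> b \<longrightarrow>
        (\<exists>!h. h \<in> hom C M P \<and> p \<cdot>\<^bsub>C\<^esub> h = a \<and> q \<cdot>\<^bsub>C\<^esub> h = b))"

definition is_pushout ::
  "('o, 'm, 'b) cat_scheme \<Rightarrow> 'm \<Rightarrow> 'm \<Rightarrow> 'o \<Rightarrow> 'm \<Rightarrow> 'm \<Rightarrow> bool" where
  "is_pushout C f g P i j \<longleftrightarrow>
     f \<in> arr C \<and> g \<in> arr C \<and> src C f = src C g \<and>
     i \<in> hom C (tgt C f) P \<and> j \<in> hom C (tgt C g) P \<and> i \<cdot>\<^bsub>C\<^esub> f = j \<cdot>\<^bsub>C\<^esub> g \<and>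
     (\<forall>M. \<forall>a\<in>hom C (tgt C f) M. \<forall>b\<in>hom C (tgt C g) M. a \<cdot>\<^bsub>C\<^esub> f = b \<cdot>\<^bsub>C\<^esub> g \<longrightarrow>
        (\<exists>!h. h \<in> hom C P M \<and> h \<cdot>\<^bsub>C\<^esub> i = a \<and> h \<cdot>\<^bsub>C\<^esub> j = b))"


section \<open>Classes of maps\<close>

definition has_lift :: "('o, 'm, 'b) cat_scheme \<Rightarrow> 'm \<Rightarrow> 'm \<Rightarrow> bool" where
  "has_lift C i p \<longleftrightarrow>
     (\<forall>u\<in>hom C (src C i) (src C p). \<forall>v\<in>hom C (tgt C i) (tgt C p).
        p \<cdot>\<^bsub>C\<^esub> u = v \<cdot>\<^bsub>C\<^esub> i \<longrightarrow>
        (\<exists>h\<in>hom C (tgt C i) (src C p). h \<cdot>\<^bsub>C\<^esub> i = u \<and> p \<cdot>\<^bsub>C\<^esub> h = v))"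

definition weak_factorization_system ::
  "('o, 'm, 'b) cat_scheme \<Rightarrow> 'm set \<Rightarrow> 'm set \<Rightarrow> bool" where
  "weak_factorization_system C L R \<longleftrightarrow>
     L = {i \<in> arr C. \<forall>p\<in>R. has_lift C i p} \<and>
     R = {p \<in> arr C. \<forall>i\<in>L. has_lift C i p} \<and>
     (\<forall>f\<in>arr C. \<exists>i\<in>L. \<exists>p\<in>R. tgt C i = src C p \<and> p \<cdot>\<^bsub>C\<^esub> i = f)"

definition is_retract :: "('o, 'm, 'b) cat_scheme \<Rightarrow> 'm \<Rightarrow> 'm \<Rightarrow> bool" where
  "is_retract C f g \<longleftrightarrow>
     (\<exists>s\<in>hom C (src C f) (src C g). \<exists>r\<in>hom C (src C g) (src C f).
      \<exists>s'\<in>hom C (tgt C f) (tgt C g). \<exists>r'\<in>hom C (tgt C g) (tgt C f).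
        r \<cdot>\<^bsub>C\<^esub> s = idn C (src C f) \<and> r' \<cdot>\<^bsub>C\<^esub> s' = idn C (tgt C f) \<and>
        g \<cdot>\<^bsub>C\<^esub> s = s' \<cdot>\<^bsub>C\<^esub> f \<and> f \<cdot>\<^bsub>C\<^esub> r = r' \<cdot>\<^bsub>C\<^esub> g)"

definition retract_stable :: "('o, 'm, 'b) cat_scheme \<Rightarrow> 'm set \<Rightarrow> bool" where
  "retract_stable C S \<longleftrightarrow> (\<forall>f\<in>arr C. \<forall>g\<in>S. is_retract C f g \<longrightarrow> f \<in> S)"

definition two_out_of_three :: "('o, 'm, 'b) cat_scheme \<Rightarrow> 'm set \<Rightarrow> bool" where
  "two_out_of_three C S \<longleftrightarrow>
     (\<forall>f\<in>arr C. \<forall>g\<in>arr C. tgt C f = src C g \<longrightarrow>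
        (f \<in> S \<and> g \<in> S \<longrightarrow> g \<cdot>\<^bsub>C\<^esub> f \<in> S) \<and>
        (f \<in> S \<and> g \<cdot>\<^bsub>C\<^esub> f \<in> S \<longrightarrow> g \<in> S) \<and>
        (g \<in> S \<and> g \<cdot>\<^bsub>C\<^esub> f \<in> S \<longrightarrow> f \<in> S))"

definition pushout_stable :: "('o, 'm, 'b) cat_scheme \<Rightarrow> 'm set \<Rightarrow> bool" where
  "pushout_stable C S \<longleftrightarrow> (\<forall>f\<in>S. \<forall>g P i j. is_pushout C f g P i j \<longrightarrow> j \<in> S)"

definition cofibrant_wrt :: "('o, 'm, 'b) cat_scheme \<Rightarrow> 'm set \<Rightarrow> 'o \<Rightarrow> bool" where
  "cofibrant_wrt C Cof X \<longleftrightarrow> (\<exists>Z. is_initial C Z \<and> (\<exists>f\<in>hom C Z X. f \<in> Cof))"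

definition fibrant_wrt :: "('o, 'm, 'b) cat_scheme \<Rightarrow> 'm set \<Rightarrow> 'o \<Rightarrow> bool" where
  "fibrant_wrt C Fib X \<longleftrightarrow> (\<exists>T. is_terminal C T \<and> (\<exists>f\<in>hom C X T. f \<in> Fib))"


section \<open>Premodel and weak model categories\<close>

record ('o, 'm) premodel = "('o, 'm) cat" +
  cof :: "'m set"
  anfib :: "'m set"
  ancof :: "'m set"
  fib :: "'m set"

definition premodel_category :: "'u itself \<Rightarrow> ('o, 'm) premodel \<Rightarrow> bool" where
  "premodel_category U C \<longleftrightarrow>
     category C \<and> complete_cat U C \<and> cocomplete_cat U C \<and>
     weak_factorization_system C (cof C) (anfib C) \<and>
     weak_factorization_system C (ancof C) (fib C) \<and>
     ancof C \<subseteq> cof C"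

abbreviation cofibrant :: "('o, 'm) premodel \<Rightarrow> 'o \<Rightarrow> bool" where
  "cofibrant C \<equiv> cofibrant_wrt C (cof C)"

abbreviation fibrant :: "('o, 'm) premodel \<Rightarrow> 'o \<Rightarrow> bool" where
  "fibrant C \<equiv> fibrant_wrt C (fib C)"

definition acyclic_cof :: "('o, 'm) premodel \<Rightarrow> 'm set" where
  "acyclic_cof C = {i \<in> cof C. \<forall>p\<in>fib C.
     fibrant C (src C p) \<and> fibrant C (tgt C p) \<longrightarrow> has_lift C i p}"

definition acyclic_fib :: "('o, 'm) premodel \<Rightarrow> 'm set" where
  "acyclic_fib C = {p \<in> fib C. \<forall>i\<in>cof C.
     cofibrant C (src C i) \<and> cofibrant C (tgt C i) \<longrightarrow> has_lift C i p}"

text \<open>In the following three definitions the (co)diagonal \<open>d\<close> is the map determined by its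
  composites with the coprojections \<open>i\<^sub>0, i\<^sub>1\<close>, respectively the projections \<open>p\<^sub>0, p\<^sub>1\<close>. Since
  pushouts, pullbacks and products are unique up to isomorphism, it does not matter which one is
  used.\<close>

definition has_relative_strong_cylinder :: "('o, 'm) premodel \<Rightarrow> 'm \<Rightarrow> bool" where
  "has_relative_strong_cylinder C f \<longleftrightarrow>
     (\<exists>Q i\<^sub>0 i\<^sub>1 d I j q.
        is_pushout C f f Q i\<^sub>0 i\<^sub>1 \<and>
        d \<in> hom C Q (tgt C f) \<and>
        d \<cdot>\<^bsub>C\<^esub> i\<^sub>0 = idn C (tgt C f) \<and> d \<cdot>\<^bsub>C\<^esub> i\<^sub>1 = idn C (tgt C f) \<and>
        j \<in> hom C Q I \<and> q \<in> hom C I (tgt C f) \<and> q \<cdot>\<^bsub>C\<^esub> j = d \<and>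
        j \<in> cof C \<and> j \<cdot>\<^bsub>C\<^esub> i\<^sub>0 \<in> acyclic_cof C)"

definition has_relative_strong_path :: "('o, 'm) premodel \<Rightarrow> 'm \<Rightarrow> bool" where
  "has_relative_strong_path C f \<longleftrightarrow>
     (\<exists>Q p\<^sub>0 p\<^sub>1 d P s e.
        is_pullback C f f Q p\<^sub>0 p\<^sub>1 \<and>
        d \<in> hom C (src C f) Q \<and>
        p\<^sub>0 \<cdot>\<^bsub>C\<^esub> d = idn C (src C f) \<and> p\<^sub>1 \<cdot>\<^bsub>C\<^esub> d = idn C (src C f) \<and>
        s \<in> hom C (src C f) P \<and> e \<in> hom C P Q \<and> e \<cdot>\<^bsub>C\<^esub> s = d \<and>
        e \<in> fib C \<and> p\<^sub>0 \<cdot>\<^bsub>C\<^esub> e \<in> acyclic_fib C)"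

definition has_strong_path :: "('o, 'm) premodel \<Rightarrow> 'o \<Rightarrow> bool" where
  "has_strong_path C X \<longleftrightarrow>
     (\<exists>Q p\<^sub>0 p\<^sub>1 d P s e.
        is_product C X X Q p\<^sub>0 p\<^sub>1 \<and>
        d \<in> hom C X Q \<and> p\<^sub>0 \<cdot>\<^bsub>C\<^esub> d = idn C X \<and> p\<^sub>1 \<cdot>\<^bsub>C\<^esub> d = idn C X \<and>
        s \<in> hom C X P \<and> e \<in> hom C P Q \<and> e \<cdot>\<^bsub>C\<^esub> s = d \<and>
        e \<in> fib C \<and> p\<^sub>0 \<cdot>\<^bsub>C\<^esub> e \<in> acyclic_fib C)"

definition weak_model_category :: "'u itself \<Rightarrow> ('o, 'm) premodel \<Rightarrow> bool" where
  "weak_model_category U C \<longleftrightarrow>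
     premodel_category U C \<and>
     (\<forall>f\<in>cof C. cofibrant C (src C f) \<and> fibrant C (tgt C f) \<longrightarrow>
        has_relative_strong_cylinder C f) \<and>
     (\<forall>f\<in>fib C. cofibrant C (src C f) \<and> fibrant C (tgt C f) \<longrightarrow>
        has_relative_strong_path C f)"

definition left_saturated :: "('o, 'm) premodel \<Rightarrow> bool" where
  "left_saturated C \<longleftrightarrow> acyclic_cof C \<subseteq> ancof C"

definition core_right_saturated :: "('o, 'm) premodel \<Rightarrow> bool" where
  "core_right_saturated C \<longleftrightarrow>
     (\<forall>p\<in>acyclic_fib C. fibrant C (tgt C p) \<longrightarrow> p \<in> anfib C)"


section \<open>Right semi-model categories\<close>

definition fresse_right_semi_model ::
  "'u itself \<Rightarrow> ('o, 'm, 'b) cat_scheme \<Rightarrow> 'm set \<Rightarrow> 'm set \<Rightarrow> 'm set \<Rightarrow> bool" where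
  "fresse_right_semi_model U C W Cof Fib \<longleftrightarrow>
     category C \<and> complete_cat U C \<and> cocomplete_cat U C \<and>
     W \<subseteq> arr C \<and> Cof \<subseteq> arr C \<and> Fib \<subseteq> arr C \<and>
     two_out_of_three C W \<and>
     retract_stable C W \<and> retract_stable C Cof \<and> retract_stable C Fib \<and>
     (\<forall>f\<in>arr C. fibrant_wrt C Fib (tgt C f) \<longrightarrow>
        (\<exists>i\<in>Cof. \<exists>p\<in>Fib \<inter> W. tgt C i = src C p \<and> p \<cdot>\<^bsub>C\<^esub> i = f) \<and>
        (\<exists>i\<in>Cof \<inter> W. \<exists>p\<in>Fib. tgt C i = src C p \<and> p \<cdot>\<^bsub>C\<^esub> i = f)) \<and>
     (\<forall>i\<in>Cof. \<forall>p\<in>Fib. fibrant_wrt C Fib (tgt C p) \<and> (i \<in> W \<or> p \<in> W) \<longrightarrow> has_lift C i p) \<and>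
     pushout_stable C Cof \<and>
     (\<forall>T. is_terminal C T \<longrightarrow> fibrant_wrt C Fib T)"

definition spitzweck_right_semi_model ::
  "'u itself \<Rightarrow> ('o, 'm, 'b) cat_scheme \<Rightarrow> 'm set \<Rightarrow> 'm set \<Rightarrow> 'm set \<Rightarrow> bool" where
  "spitzweck_right_semi_model U C W Cof Fib \<longleftrightarrow>
     fresse_right_semi_model U C W Cof Fib \<and>
     weak_factorization_system C (Cof \<inter> W) Fib"

end

theory Submission
  imports Defs
begin

text \<open>Suppose first that \<open>W\<close> is the class of equivalences of a Fresse right semi-model structure. Two
  retract arguments show that \<open>W\<close> meets the core fibrations exactly in the core anodyne fibrations
  (\<open>core_fib_equiv_iff\<close>) and the cofibrations exactly in the acyclic cofibrations
  (\<open>cof_equiv_eq\<close>). Cylinders and path objects then arise by factoring codiagonals and diagonals;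
  core right saturation is a third retract argument, made possible by cofibrant replacement. The
  two identifications also determine \<open>W\<close>: up to composition with anodyne cofibrations every map is
  a core fibration (\<open>equiv_characterization\<close>). And they identify the trivial cofibrations, so that
  these form a weak factorization system with the fibrations precisely when every acyclic
  cofibration is anodyne.

  Conversely, call a map \<open>f\<close> between fibrant objects a core equivalence if every square from a
  cofibration \<open>a\<close> with cofibrant source and fibrant target to \<open>f\<close> has a filler whose upper triangle
  commutes and whose lower triangle commutes up to homotopy relative to the source of \<open>a\<close>. With
  this definition closure under composition, left cancellation and retracts are short
  manipulations of homotopies, and a core equivalence that is a fibration is acyclic, because
  homotopies lift along fibrations; by core right saturation it is anodyne. The strong path objects
  of all fibrant objects are used for two purposes: they make relative homotopy an equivalence
  relation on maps into any fibrant object (\<open>homotopic_trans\<close>), and they make an anodyne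
  cofibration between fibrant objects a strong deformation retract, hence a core equivalence
  (\<open>core_equiv_ancof\<close>).

  The delicate point is right cancellation (\<open>core_equiv_cancel_right\<close>). Cofibrant replacement
  reduces it to the following: if \<open>q \<cdot> d\<close> is a core equivalence, where \<open>d\<close> is an acyclic
  cofibration with cofibrant source and \<open>q\<close> is a fibration, then \<open>q\<close> is anodyne
  (\<open>fib_after_acyclic_cof_anfib\<close>). There \<open>q \<cdot> d\<close> also factors as an anodyne fibration after an
  acyclic cofibration, the two factorizations map to each other, and a relative path object of
  \<open>q\<close> contracts one of the two composites to the identity over the base.

  Finally a map between arbitrary objects is an equivalence if a fibrant replacement of it is a
  core equivalence. Fibrant replacement need not be functorial, but replacements can be pushed
  forward along maps of arrows (\<open>fibrant_approx_push\<close>). This gives independence of the choices and,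
  with a homotopical version of closure under retracts, the axioms.\<close>

section \<open>Composition, lifting and classes of maps\<close>

context category
begin

lemma homD:
  assumes "f \<in> hom C A B"
  shows "f \<in> arr C" "src C f = A" "tgt C f = B" "A \<in> obj C" "B \<in> obj C"
  using assms src_obj tgt_obj by (auto simp: hom_def)

lemma homI: "\<lbrakk>f \<in> arr C; src C f = A; tgt C f = B\<rbrakk> \<Longrightarrow> f \<in> hom C A B"
  by (simp add: hom_def)

lemma arr_hom: "f \<in> arr C \<Longrightarrow> f \<in> hom C (src C f) (tgt C f)"
  by (simp add: hom_def)

lemma cmp_arr [simp]:
  assumes "f \<in> arr C" "g \<in> arr C" "tgt C f = src C g"
  shows "g \<cdot> f \<in> arr C" "src C (g \<cdot> f) = src C f" "tgt C (g \<cdot> f) = tgt C g"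
  using cmp_hom[of f "src C f" "tgt C f" g "tgt C g"] assms by (auto simp: hom_def)

lemma cmp_assoc_arr [simp]:
  assumes "f \<in> arr C" "g \<in> arr C" "h \<in> arr C" "tgt C f = src C g" "tgt C g = src C h"
  shows "h \<cdot> g \<cdot> f = h \<cdot> (g \<cdot> f)"
  using cmp_assoc[of f "src C f" "tgt C f" g "tgt C g" h "tgt C h"] assms by (auto simp: hom_def)

lemma idn_arr [simp]:
  assumes "A \<in> obj C"
  shows "idn C A \<in> arr C" "src C (idn C A) = A" "tgt C (idn C A) = A"
  using idn_hom[OF assms] by (auto simp: hom_def)

lemma cmp_idn_arr [simp]: "\<lbrakk>f \<in> arr C; src C f = A\<rbrakk> \<Longrightarrow> f \<cdot> idn C A = f"
  and idn_cmp_arr [simp]: "\<lbrakk>f \<in> arr C; tgt C f = A\<rbrakk> \<Longrightarrow> idn C A \<cdot> f = f"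
  using cmp_idn[of f A "tgt C f"] idn_cmp[of f "src C f" A] by (auto simp: hom_def)

text \<open>Composites are kept bracketed to the right; this turns an equation between composites into a
  rewrite rule that also applies when a further map is composed on the right.\<close>

lemma whisker:
  assumes "g \<cdot> f = k" "f \<in> arr C" "g \<in> arr C" "tgt C f = src C g" "x \<in> arr C" "tgt C x = src C f"
  shows "g \<cdot> (f \<cdot> x) = k \<cdot> x"
  using assms cmp_assoc_arr[of x f g] by simp

lemma has_liftI:
  assumes "i \<in> hom C A B" "p \<in> hom C X Y"
    and "\<And>u v. \<lbrakk>u \<in> hom C A X; v \<in> hom C B Y; p \<cdot> u = v \<cdot> i\<rbrakk>
      \<Longrightarrow> \<exists>h\<in>hom C B X. h \<cdot> i = u \<and> p \<cdot> h = v"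
  shows "has_lift C i p"
  using assms(3) unfolding has_lift_def by (simp add: homD[OF assms(1)] homD[OF assms(2)])

lemma has_liftE:
  assumes "has_lift C i p" "i \<in> hom C A B" "p \<in> hom C X Y" "u \<in> hom C A X" "v \<in> hom C B Y"
    "p \<cdot> u = v \<cdot> i"
  obtains h where "h \<in> hom C B X" "h \<cdot> i = u" "p \<cdot> h = v"
  using assms(1,4,5,6) that unfolding has_lift_def
  by (auto simp: homD[OF assms(2)] homD[OF assms(3)])

lemma has_lift_idn_left:
  assumes "A \<in> obj C" "p \<in> arr C"
  shows "has_lift C (idn C A) p"
proof (rule has_liftI[OF idn_hom[OF assms(1)] arr_hom[OF assms(2)]])
  fix u v
  assume a: "u \<in> hom C A (src C p)" "v \<in> hom C A (tgt C p)" "p \<cdot> u = v \<cdot> idn C A"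
  then show "\<exists>h\<in>hom C A (src C p). h \<cdot> idn C A = u \<and> p \<cdot> h = v"
    by (intro bexI[of _ u]) (auto simp: homD[OF a(1)] homD[OF a(2)])
qed

lemma has_lift_idn_right:
  assumes "X \<in> obj C" "i \<in> arr C"
  shows "has_lift C i (idn C X)"
proof (rule has_liftI[OF arr_hom[OF assms(2)] idn_hom[OF assms(1)]])
  fix u v
  assume a: "u \<in> hom C (src C i) X" "v \<in> hom C (tgt C i) X" "idn C X \<cdot> u = v \<cdot> i"
  then show "\<exists>h\<in>hom C (tgt C i) X. h \<cdot> i = u \<and> idn C X \<cdot> h = v"
    by (intro bexI[of _ v]) (auto simp: homD[OF a(1)] homD[OF a(2)])
qed

lemma has_lift_cmp_left:
  assumes "has_lift C i p" "has_lift C j p" "i \<in> hom C A B" "j \<in> hom C B D" "p \<in> arr C"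
  shows "has_lift C (j \<cdot> i) p"
proof (rule has_liftI[OF cmp_hom[OF assms(3,4)] arr_hom[OF assms(5)]])
  fix u v
  assume a: "u \<in> hom C A (src C p)" "v \<in> hom C D (tgt C p)" "p \<cdot> u = v \<cdot> (j \<cdot> i)"
  note [simp] = homD[OF assms(3)] homD[OF assms(4)] homD[OF a(1)] homD[OF a(2)] assms(5)
  have vj: "v \<cdot> j \<in> hom C B (tgt C p)" using cmp_hom[OF assms(4) a(2)] .
  obtain h where h: "h \<in> hom C B (src C p)" "h \<cdot> i = u" "p \<cdot> h = v \<cdot> j"
    using has_liftE[OF assms(1,3) arr_hom[OF assms(5)] a(1) vj] a(3) by auto
  obtain k where k: "k \<in> hom C D (src C p)" "k \<cdot> j = h" "p \<cdot> k = v"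
    using has_liftE[OF assms(2,4) arr_hom[OF assms(5)] h(1) a(2) h(3)] by auto
  note [simp] = homD[OF h(1)] homD[OF k(1)]
  have "k \<cdot> (j \<cdot> i) = u" by (simp add: whisker[OF k(2)] h(2))
  then show "\<exists>h\<in>hom C D (src C p). h \<cdot> (j \<cdot> i) = u \<and> p \<cdot> h = v" using k by auto
qed

lemma has_lift_cmp_right:
  assumes "has_lift C i p" "has_lift C i q" "p \<in> hom C X Y" "q \<in> hom C Y Z" "i \<in> arr C"
  shows "has_lift C i (q \<cdot> p)"
proof (rule has_liftI[OF arr_hom[OF assms(5)] cmp_hom[OF assms(3,4)]])
  fix u v
  assume a: "u \<in> hom C (src C i) X" "v \<in> hom C (tgt C i) Z" "q \<cdot> p \<cdot> u = v \<cdot> i"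
  note [simp] = homD[OF assms(3)] homD[OF assms(4)] homD[OF a(1)] homD[OF a(2)] assms(5)
  have pu: "p \<cdot> u \<in> hom C (src C i) Y" using cmp_hom[OF a(1) assms(3)] .
  obtain h where h: "h \<in> hom C (tgt C i) Y" "h \<cdot> i = p \<cdot> u" "q \<cdot> h = v"
    using has_liftE[OF assms(2) arr_hom[OF assms(5)] assms(4) pu a(2)] a(3) by auto
  obtain k where k: "k \<in> hom C (tgt C i) X" "k \<cdot> i = u" "p \<cdot> k = h"
    using has_liftE[OF assms(1) arr_hom[OF assms(5)] assms(3) a(1) h(1)] h(2) by auto
  note [simp] = homD[OF h(1)] homD[OF k(1)]
  have "q \<cdot> p \<cdot> k = v" by (simp add: k(3) h(3))
  then show "\<exists>h\<in>hom C (tgt C i) X. h \<cdot> i = u \<and> q \<cdot> p \<cdot> h = v" using k by auto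
qed

lemma pushoutD:
  assumes "is_pushout C f g P i j" "f \<in> hom C A B" "g \<in> hom C A D"
  shows "i \<in> hom C B P" "j \<in> hom C D P" "i \<cdot> f = j \<cdot> g"
  using assms(1) unfolding is_pushout_def by (auto simp: homD[OF assms(2)] homD[OF assms(3)])

lemma pushout_univ:
  assumes "is_pushout C f g P i j" "f \<in> hom C A B" "g \<in> hom C A D"
    "a \<in> hom C B M" "b \<in> hom C D M" "a \<cdot> f = b \<cdot> g"
  obtains h where "h \<in> hom C P M" "h \<cdot> i = a" "h \<cdot> j = b"
  using assms(1,4,5,6) that unfolding is_pushout_def
  by (auto simp: homD[OF assms(2)] homD[OF assms(3)]) blast

lemma pushout_eq:
  assumes P: "is_pushout C f g P i j" and "f \<in> hom C A B" "g \<in> hom C A D"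
    "h \<in> hom C P M" "k \<in> hom C P M" "h \<cdot> i = k \<cdot> i" "h \<cdot> j = k \<cdot> j"
  shows "h = k"
proof -
  note po = pushoutD[OF assms(1-3)]
  note [simp] = homD[OF assms(2)] homD[OF assms(3)] homD[OF po(1)] homD[OF po(2)]
    homD[OF assms(4)] homD[OF assms(5)]
  have "h \<cdot> i \<in> hom C B M" "h \<cdot> j \<in> hom C D M" by (simp_all add: homI)
  moreover have "(h \<cdot> i) \<cdot> f = (h \<cdot> j) \<cdot> g" using po(3) by simp
  ultimately have "\<exists>!l. l \<in> hom C P M \<and> l \<cdot> i = h \<cdot> i \<and> l \<cdot> j = h \<cdot> j"
    using P unfolding is_pushout_def by simp
  then show ?thesis using assms(4-7) by metis
qed

lemma pullbackD:
  assumes "is_pullback C f g P p q" "f \<in> hom C A D" "g \<in> hom C B D"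
  shows "p \<in> hom C P A" "q \<in> hom C P B" "f \<cdot> p = g \<cdot> q"
  using assms(1) unfolding is_pullback_def by (auto simp: homD[OF assms(2)] homD[OF assms(3)])

lemma pullback_univ:
  assumes "is_pullback C f g P p q" "f \<in> hom C A D" "g \<in> hom C B D"
    "a \<in> hom C M A" "b \<in> hom C M B" "f \<cdot> a = g \<cdot> b"
  obtains h where "h \<in> hom C M P" "p \<cdot> h = a" "q \<cdot> h = b"
  using assms(1,4,5,6) that unfolding is_pullback_def
  by (auto simp: homD[OF assms(2)] homD[OF assms(3)]) blast

lemma pullback_eq:
  assumes P: "is_pullback C f g P p q" and "f \<in> hom C A D" "g \<in> hom C B D"
    "h \<in> hom C M P" "k \<in> hom C M P" "p \<cdot> h = p \<cdot> k" "q \<cdot> h = q \<cdot> k"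
  shows "h = k"
proof -
  note po = pullbackD[OF assms(1-3)]
  note [simp] = homD[OF assms(2)] homD[OF assms(3)] homD[OF po(1)] homD[OF po(2)]
    homD[OF assms(4)] homD[OF assms(5)]
  have "p \<cdot> h \<in> hom C M A" "q \<cdot> h \<in> hom C M B" by (simp_all add: homI)
  moreover have "f \<cdot> (p \<cdot> h) = g \<cdot> (q \<cdot> h)" using whisker[OF po(3)] by simp
  ultimately have "\<exists>!l. l \<in> hom C M P \<and> p \<cdot> l = p \<cdot> h \<and> q \<cdot> l = q \<cdot> h"
    using P unfolding is_pullback_def by simp
  then show ?thesis using assms(4-7) by metis
qed

lemma has_lift_pushout:
  assumes P: "is_pushout C f g P i j" and f: "f \<in> hom C A B" and g: "g \<in> hom C A D"
    and p: "p \<in> arr C" and l: "has_lift C f p"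
  shows "has_lift C j p"
proof -
  note po = pushoutD[OF P f g]
  show ?thesis
  proof (rule has_liftI[OF po(2) arr_hom[OF p]])
    fix u v
    assume a: "u \<in> hom C D (src C p)" "v \<in> hom C P (tgt C p)" "p \<cdot> u = v \<cdot> j"
    note [simp] = homD[OF f] homD[OF g] homD[OF po(1)] homD[OF po(2)] p
      homD[OF a(1)] homD[OF a(2)]
    have 1: "u \<cdot> g \<in> hom C A (src C p)" "v \<cdot> i \<in> hom C B (tgt C p)" by (simp_all add: homI)
    have 2: "p \<cdot> (u \<cdot> g) = (v \<cdot> i) \<cdot> f" by (simp add: po(3) whisker[OF a(3)])
    obtain h where h: "h \<in> hom C B (src C p)" "h \<cdot> f = u \<cdot> g" "p \<cdot> h = v \<cdot> i"
      using has_liftE[OF l f arr_hom[OF p] 1 2] .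
    note [simp] = homD[OF h(1)]
    obtain k where k: "k \<in> hom C P (src C p)" "k \<cdot> i = h" "k \<cdot> j = u"
      using pushout_univ[OF P f g h(1) a(1) h(2)] .
    note [simp] = homD[OF k(1)]
    have "p \<cdot> k = v"
      by (rule pushout_eq[OF P f g _ a(2)]) (simp_all add: homI k(2,3) h(3) a(3))
    then show "\<exists>h\<in>hom C P (src C p). h \<cdot> j = u \<and> p \<cdot> h = v" using k by auto
  qed
qed

lemma has_lift_pullback:
  assumes P: "is_pullback C f g P p q" and f: "f \<in> hom C A D" and g: "g \<in> hom C B D"
    and i: "i \<in> arr C" and l: "has_lift C i f"
  shows "has_lift C i q"
proof -
  note po = pullbackD[OF P f g]
  show ?thesis
  proof (rule has_liftI[OF arr_hom[OF i] po(2)])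
    fix u v
    assume a: "u \<in> hom C (src C i) P" "v \<in> hom C (tgt C i) B" "q \<cdot> u = v \<cdot> i"
    note [simp] = homD[OF f] homD[OF g] homD[OF po(1)] homD[OF po(2)] i
      homD[OF a(1)] homD[OF a(2)]
    have 1: "p \<cdot> u \<in> hom C (src C i) A" "g \<cdot> v \<in> hom C (tgt C i) D" by (simp_all add: homI)
    have 2: "f \<cdot> (p \<cdot> u) = (g \<cdot> v) \<cdot> i" by (simp add: whisker[OF po(3)] a(3))
    obtain h where h: "h \<in> hom C (tgt C i) A" "h \<cdot> i = p \<cdot> u" "f \<cdot> h = g \<cdot> v"
      using has_liftE[OF l arr_hom[OF i] f 1 2] .
    note [simp] = homD[OF h(1)]
    obtain k where k: "k \<in> hom C (tgt C i) P" "p \<cdot> k = h" "q \<cdot> k = v"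
      using pullback_univ[OF P f g h(1) a(2) h(3)] .
    note [simp] = homD[OF k(1)]
    have "k \<cdot> i = u"
      by (rule pullback_eq[OF P f g _ a(1)])
        (simp_all add: homI whisker[OF k(2)] whisker[OF k(3)] h(2) a(3))
    then show "\<exists>h\<in>hom C (tgt C i) P. h \<cdot> i = u \<and> q \<cdot> h = v" using k by auto
  qed
qed

lemma has_lift_retract_left:
  assumes r: "is_retract C f g" and f: "f \<in> arr C" and g: "g \<in> arr C" and p: "p \<in> arr C"
    and l: "has_lift C g p"
  shows "has_lift C f p"
proof (rule has_liftI[OF arr_hom[OF f] arr_hom[OF p]])
  fix u v
  assume a: "u \<in> hom C (src C f) (src C p)" "v \<in> hom C (tgt C f) (tgt C p)" "p \<cdot> u = v \<cdot> f"
  obtain s r s' r' where s: "s \<in> hom C (src C f) (src C g)" and r: "r \<in> hom C (src C g) (src C f)"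
    and s': "s' \<in> hom C (tgt C f) (tgt C g)" and r': "r' \<in> hom C (tgt C g) (tgt C f)"
    and e: "r \<cdot> s = idn C (src C f)" "r' \<cdot> s' = idn C (tgt C f)" "g \<cdot> s = s' \<cdot> f" "f \<cdot> r = r' \<cdot> g"
    using r unfolding is_retract_def by blast
  note [simp] = f g p homD[OF a(1)] homD[OF a(2)] homD[OF s] homD[OF r] homD[OF s'] homD[OF r']
  have 1: "u \<cdot> r \<in> hom C (src C g) (src C p)" "v \<cdot> r' \<in> hom C (tgt C g) (tgt C p)"
    by (simp_all add: homI)
  have 2: "p \<cdot> (u \<cdot> r) = (v \<cdot> r') \<cdot> g" by (simp add: whisker[OF a(3)] e(4))
  obtain h where h: "h \<in> hom C (tgt C g) (src C p)" "h \<cdot> g = u \<cdot> r" "p \<cdot> h = v \<cdot> r'"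
    using has_liftE[OF l arr_hom[OF g] arr_hom[OF p] 1 2] .
  note [simp] = homD[OF h(1)]
  have "(h \<cdot> s') \<cdot> f = u" using e(3) whisker[OF h(2), of s] by (simp add: e(1))
  moreover have "p \<cdot> (h \<cdot> s') = v" by (simp add: whisker[OF h(3)] e(2))
  moreover have "h \<cdot> s' \<in> hom C (tgt C f) (src C p)" by (simp add: homI)
  ultimately show "\<exists>h\<in>hom C (tgt C f) (src C p). h \<cdot> f = u \<and> p \<cdot> h = v" by blast
qed

lemma has_lift_retract_right:
  assumes r: "is_retract C f g" and f: "f \<in> arr C" and g: "g \<in> arr C" and i: "i \<in> arr C"
    and l: "has_lift C i g"
  shows "has_lift C i f"
proof (rule has_liftI[OF arr_hom[OF i] arr_hom[OF f]])
  fix u v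
  assume a: "u \<in> hom C (src C i) (src C f)" "v \<in> hom C (tgt C i) (tgt C f)" "f \<cdot> u = v \<cdot> i"
  obtain s r s' r' where s: "s \<in> hom C (src C f) (src C g)" and r: "r \<in> hom C (src C g) (src C f)"
    and s': "s' \<in> hom C (tgt C f) (tgt C g)" and r': "r' \<in> hom C (tgt C g) (tgt C f)"
    and e: "r \<cdot> s = idn C (src C f)" "r' \<cdot> s' = idn C (tgt C f)" "g \<cdot> s = s' \<cdot> f" "f \<cdot> r = r' \<cdot> g"
    using r unfolding is_retract_def by blast
  note [simp] = f g i homD[OF a(1)] homD[OF a(2)] homD[OF s] homD[OF r] homD[OF s'] homD[OF r']
  have 1: "s \<cdot> u \<in> hom C (src C i) (src C g)" "s' \<cdot> v \<in> hom C (tgt C i) (tgt C g)"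
    by (simp_all add: homI)
  have 2: "g \<cdot> (s \<cdot> u) = (s' \<cdot> v) \<cdot> i" by (simp add: whisker[OF e(3)] a(3))
  obtain h where h: "h \<in> hom C (tgt C i) (src C g)" "h \<cdot> i = s \<cdot> u" "g \<cdot> h = s' \<cdot> v"
    using has_liftE[OF l arr_hom[OF i] arr_hom[OF g] 1 2] .
  note [simp] = homD[OF h(1)]
  have "(r \<cdot> h) \<cdot> i = u" using whisker[OF e(1), of u] by (simp add: h(2))
  moreover have "f \<cdot> (r \<cdot> h) = v" using whisker[OF e(2), of v] by (simp add: whisker[OF e(4)] h(3))
  moreover have "r \<cdot> h \<in> hom C (tgt C i) (src C f)" by (simp add: homI)
  ultimately show "\<exists>h\<in>hom C (tgt C i) (src C f). h \<cdot> i = u \<and> f \<cdot> h = v" by blast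
qed

text \<open>This and its dual are the retract argument: a lift in the square between a factor and the
  composite is the nontrivial leg of the retraction.\<close>

lemma retract_of_left_factor:
  assumes i: "i \<in> hom C A E" and p: "p \<in> hom C E B" and l: "has_lift C (p \<cdot> i) p"
  shows "is_retract C (p \<cdot> i) i"
proof -
  note [simp] = homD[OF i] homD[OF p]
  have pi: "p \<cdot> i \<in> hom C A B" by (simp add: homI)
  have "p \<cdot> i = idn C B \<cdot> (p \<cdot> i)" by simp
  from has_liftE[OF l pi p i idn_hom[OF homD(5)[OF p]] this]
  obtain h where h: "h \<in> hom C B E" "h \<cdot> (p \<cdot> i) = i" "p \<cdot> h = idn C B" .
  note [simp] = homD[OF h(1)]
  show ?thesis unfolding is_retract_def
    by (rule bexI[of _ "idn C A"], rule bexI[of _ "idn C A"], rule bexI[of _ h], rule bexI[of _ p])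
      (simp_all add: homI h)
qed

lemma retract_of_right_factor:
  assumes i: "i \<in> hom C X E" and q: "q \<in> hom C E Y" and l: "has_lift C i (q \<cdot> i)"
  shows "is_retract C (q \<cdot> i) q"
proof -
  note [simp] = homD[OF i] homD[OF q]
  have qi: "q \<cdot> i \<in> hom C X Y" by (simp add: homI)
  have "(q \<cdot> i) \<cdot> idn C X = q \<cdot> i" by simp
  from has_liftE[OF l i qi idn_hom[OF homD(4)[OF i]] q this]
  obtain h where h: "h \<in> hom C E X" "h \<cdot> i = idn C X" "(q \<cdot> i) \<cdot> h = q" .
  note [simp] = homD[OF h(1)]
  show ?thesis unfolding is_retract_def
    by (rule bexI[of _ i], rule bexI[of _ h], rule bexI[of _ "idn C Y"], rule bexI[of _ "idn C Y"])
      (use h(3) in \<open>simp_all add: homI h(2)\<close>)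
qed

lemma wfs_arr:
  assumes "weak_factorization_system C L R"
  shows "f \<in> L \<Longrightarrow> f \<in> arr C" "f \<in> R \<Longrightarrow> f \<in> arr C"
  using assms unfolding weak_factorization_system_def by blast+

lemma wfs_lift:
  assumes "weak_factorization_system C L R" "i \<in> L" "p \<in> R"
  shows "has_lift C i p"
  using assms unfolding weak_factorization_system_def by blast

lemma wfs_leftI:
  assumes "weak_factorization_system C L R" "i \<in> arr C" "\<And>p. p \<in> R \<Longrightarrow> has_lift C i p"
  shows "i \<in> L"
  using assms unfolding weak_factorization_system_def by blast

lemma wfs_rightI:
  assumes "weak_factorization_system C L R" "p \<in> arr C" "\<And>i. i \<in> L \<Longrightarrow> has_lift C i p"
  shows "p \<in> R"
  using assms unfolding weak_factorization_system_def by blast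

lemma wfs_factor:
  assumes "weak_factorization_system C L R" "f \<in> hom C A B"
  obtains i p M where "i \<in> L" "p \<in> R" "i \<in> hom C A M" "p \<in> hom C M B" "p \<cdot> i = f"
proof -
  obtain i p where ip: "i \<in> L" "p \<in> R" "tgt C i = src C p" "p \<cdot> i = f"
    using assms homD(1)[OF assms(2)] unfolding weak_factorization_system_def by blast
  have "i \<in> arr C" "p \<in> arr C" using ip(1,2) wfs_arr[OF assms(1)] by blast+
  then show ?thesis using that[of i p "tgt C i"] ip homD[OF assms(2)]
    by (metis cmp_arr(2,3) homI)
qed

lemma wfs_left_idn: "\<lbrakk>weak_factorization_system C L R; A \<in> obj C\<rbrakk> \<Longrightarrow> idn C A \<in> L"
  by (rule wfs_leftI) (auto intro: has_lift_idn_left wfs_arr)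

lemma wfs_right_idn: "\<lbrakk>weak_factorization_system C L R; A \<in> obj C\<rbrakk> \<Longrightarrow> idn C A \<in> R"
  by (rule wfs_rightI) (auto intro: has_lift_idn_right wfs_arr)

lemma wfs_left_cmp:
  assumes "weak_factorization_system C L R" "i \<in> L" "j \<in> L" "i \<in> hom C A B" "j \<in> hom C B D"
  shows "j \<cdot> i \<in> L"
  by (rule wfs_leftI[OF assms(1)])
    (use assms in \<open>auto intro: has_lift_cmp_left wfs_lift wfs_arr homD(1)[OF cmp_hom]\<close>)

lemma wfs_right_cmp:
  assumes "weak_factorization_system C L R" "p \<in> R" "q \<in> R" "p \<in> hom C A B" "q \<in> hom C B D"
  shows "q \<cdot> p \<in> R"
  by (rule wfs_rightI[OF assms(1)])
    (use assms in \<open>auto intro: has_lift_cmp_right wfs_lift wfs_arr homD(1)[OF cmp_hom]\<close>)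

lemma wfs_left_pushout:
  assumes "weak_factorization_system C L R" "f \<in> L" "is_pushout C f g P i j"
  shows "j \<in> L"
proof (rule wfs_leftI[OF assms(1)])
  have f: "f \<in> hom C (src C f) (tgt C f)" using assms wfs_arr arr_hom by blast
  have g: "g \<in> hom C (src C f) (tgt C g)" using assms(3) by (auto simp: is_pushout_def hom_def)
  show "j \<in> arr C" using pushoutD(2)[OF assms(3) f g] homD by blast
  show "has_lift C j p" if "p \<in> R" for p
    using has_lift_pushout[OF assms(3) f g] wfs_arr[OF assms(1)] wfs_lift[OF assms(1,2)] that
    by blast
qed

lemma wfs_right_pullback:
  assumes "weak_factorization_system C L R" "f \<in> R" "is_pullback C f g P p q"
  shows "q \<in> R"
proof (rule wfs_rightI[OF assms(1)])
  have f: "f \<in> hom C (src C f) (tgt C f)" using assms wfs_arr arr_hom by blast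
  have g: "g \<in> hom C (src C g) (tgt C f)" using assms(3) by (auto simp: is_pullback_def hom_def)
  show "q \<in> arr C" using pullbackD(2)[OF assms(3) f g] homD by blast
  show "has_lift C i q" if "i \<in> L" for i
    using has_lift_pullback[OF assms(3) f g] wfs_arr[OF assms(1)] wfs_lift[OF assms(1)] assms(2) that
    by blast
qed

lemma wfs_left_retract:
  assumes "weak_factorization_system C L R" "f \<in> arr C" "g \<in> L" "is_retract C f g"
  shows "f \<in> L"
  by (rule wfs_leftI[OF assms(1,2)])
    (use assms in \<open>blast intro: has_lift_retract_left wfs_lift wfs_arr\<close>)

lemma wfs_right_retract:
  assumes "weak_factorization_system C L R" "f \<in> arr C" "g \<in> R" "is_retract C f g"
  shows "f \<in> R"
  by (rule wfs_rightI[OF assms(1,2)])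
    (use assms in \<open>blast intro: has_lift_retract_right wfs_lift wfs_arr\<close>)

end

section \<open>Finite limits and colimits\<close>

definition empty_index :: "('u, 'u) cat" where
  "empty_index = \<lparr>obj = {}, arr = {}, src = id, tgt = id, idn = id, cmp = (\<lambda>g f. f)\<rparr>"

text \<open>The elements \<open>e 0\<close>, \<open>e 1\<close>, \<open>e 2\<close> are the objects and also their own identities; \<open>e 3\<close> and \<open>e 4\<close>
  are the two arrows into \<open>e 2\<close>, respectively out of \<open>e 2\<close> for spans.\<close>

definition cospan_index :: "(nat \<Rightarrow> 'u) \<Rightarrow> ('u, 'u) cat" where
  "cospan_index e = \<lparr>obj = {e 0, e 1, e 2}, arr = {e 0, e 1, e 2, e 3, e 4},
     src = (\<lambda>x. if x = e 3 then e 0 else if x = e 4 then e 1 else x),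
     tgt = (\<lambda>x. if x = e 3 \<or> x = e 4 then e 2 else x),
     idn = id, cmp = (\<lambda>g f. if f = e 3 \<or> f = e 4 then f else g)\<rparr>"

definition span_index :: "(nat \<Rightarrow> 'u) \<Rightarrow> ('u, 'u) cat" where
  "span_index e = \<lparr>obj = {e 0, e 1, e 2}, arr = {e 0, e 1, e 2, e 3, e 4},
     src = (\<lambda>x. if x = e 3 \<or> x = e 4 then e 2 else x),
     tgt = (\<lambda>x. if x = e 3 then e 0 else if x = e 4 then e 1 else x),
     idn = id, cmp = (\<lambda>g f. if f = e 3 \<or> f = e 4 then f else g)\<rparr>"

lemma small_catI:
  fixes J :: "('u, 'u) cat"
  assumes "infinite (UNIV :: 'u set)" "category J" "finite (arr J)"
  shows "small_cat J"
  using assms finite_lesspoll_infinite unfolding small_cat_def by blast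

lemma category_empty_index: "category empty_index"
  by unfold_locales (auto simp: empty_index_def hom_def)

lemma category_cospan_index:
  assumes "inj e" shows "category (cospan_index e)"
  by unfold_locales (auto simp: cospan_index_def hom_def inj_eq[OF assms] split: if_splits)

lemma category_span_index:
  assumes "inj e" shows "category (span_index e)"
  by unfold_locales (auto simp: span_index_def hom_def inj_eq[OF assms] split: if_splits)

lemma ex_terminal:
  assumes "infinite (UNIV :: 'u set)" "complete_cat TYPE('u) C"
  shows "\<exists>T. is_terminal C T"
proof -
  have "small_cat (empty_index :: ('u, 'u) cat)"
    using small_catI[OF assms(1) category_empty_index] by (simp add: empty_index_def)
  moreover have "is_functor (empty_index :: ('u, 'u) cat) C Fo Fm" for Fo Fm
    by (simp add: is_functor_def empty_index_def)
  ultimately obtain L \<pi> where "is_limit (empty_index :: ('u, 'u) cat) C undefined undefined L \<pi>"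
    using assms(2) unfolding complete_cat_def by blast
  then have "is_terminal C L"
    by (simp add: is_limit_def is_cone_def is_terminal_def empty_index_def)
  then show ?thesis ..
qed

lemma ex_initial:
  assumes "infinite (UNIV :: 'u set)" "cocomplete_cat TYPE('u) C"
  shows "\<exists>Z. is_initial C Z"
proof -
  have "small_cat (empty_index :: ('u, 'u) cat)"
    using small_catI[OF assms(1) category_empty_index] by (simp add: empty_index_def)
  moreover have "is_functor (empty_index :: ('u, 'u) cat) C Fo Fm" for Fo Fm
    by (simp add: is_functor_def empty_index_def)
  ultimately obtain L \<iota> where "is_colimit (empty_index :: ('u, 'u) cat) C undefined undefined L \<iota>"
    using assms(2) unfolding cocomplete_cat_def by blast
  then have "is_initial C L"
    by (simp add: is_colimit_def is_cocone_def is_initial_def empty_index_def)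
  then show ?thesis ..
qed

lemma (in category) ex_pullback:
  assumes inf: "infinite (UNIV :: 'u set)" and comp: "complete_cat TYPE('u) C"
    and f: "f \<in> hom C A D" and g: "g \<in> hom C B D"
  shows "\<exists>P p q. is_pullback C f g P p q"
proof -
  obtain e :: "nat \<Rightarrow> 'u" where e: "inj e" using inf infinite_countable_subset by blast
  note [simp] = inj_eq[OF e] homD[OF f] homD[OF g]
  define Fo where "Fo = (\<lambda>x. if x = e 0 then A else if x = e 1 then B else D)"
  define Fm where "Fm = (\<lambda>x. if x = e 3 then f else if x = e 4 then g else idn C (Fo x))"
  have "small_cat (cospan_index e)"
    by (rule small_catI[OF inf category_cospan_index[OF e]]) (simp add: cospan_index_def)
  moreover have "is_functor (cospan_index e) C Fo Fm"
    by (auto simp: is_functor_def cospan_index_def Fo_def Fm_def hom_def)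
  ultimately obtain L \<pi> where L: "is_limit (cospan_index e) C Fo Fm L \<pi>"
    using comp unfolding complete_cat_def by blast
  then have cone: "is_cone (cospan_index e) C Fo Fm L \<pi>" by (simp add: is_limit_def)
  then have \<pi>: "\<pi> (e 0) \<in> hom C L A" "\<pi> (e 1) \<in> hom C L B" "\<pi> (e 2) \<in> hom C L D"
    and eq: "f \<cdot> \<pi> (e 0) = \<pi> (e 2)" "g \<cdot> \<pi> (e 1) = \<pi> (e 2)"
    by (auto simp: is_cone_def cospan_index_def Fo_def Fm_def)
  note [simp] = homD[OF \<pi>(1)] homD[OF \<pi>(2)] homD[OF \<pi>(3)]
  have "is_pullback C f g L (\<pi> (e 0)) (\<pi> (e 1))"
    unfolding is_pullback_def
  proof (intro conjI allI ballI impI)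
    fix M a b
    assume "a \<in> hom C M (src C f)" "b \<in> hom C M (src C g)" and ab: "f \<cdot> a = g \<cdot> b"
    then have a: "a \<in> hom C M A" and b: "b \<in> hom C M B" by simp_all
    note [simp] = homD[OF a] homD[OF b]
    have "is_cone (cospan_index e) C Fo Fm M (\<lambda>x. if x = e 0 then a else if x = e 1 then b else f \<cdot> a)"
      by (auto simp: is_cone_def cospan_index_def Fo_def Fm_def hom_def ab)
    then have "\<exists>!h. h \<in> hom C M L \<and> (\<forall>j\<in>obj (cospan_index e). \<pi> j \<cdot> h =
        (if j = e 0 then a else if j = e 1 then b else f \<cdot> a))"
      using L unfolding is_limit_def by blast
    moreover have "(h \<in> hom C M L \<and> (\<forall>j\<in>obj (cospan_index e). \<pi> j \<cdot> h =
        (if j = e 0 then a else if j = e 1 then b else f \<cdot> a))) \<longleftrightarrow>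
      (h \<in> hom C M L \<and> \<pi> (e 0) \<cdot> h = a \<and> \<pi> (e 1) \<cdot> h = b)" for h
      using whisker[OF eq(1), of h] by (auto simp: cospan_index_def hom_def)
    ultimately show "\<exists>!h. h \<in> hom C M L \<and> \<pi> (e 0) \<cdot> h = a \<and> \<pi> (e 1) \<cdot> h = b"
      by simp
  qed (use \<pi> eq in simp_all)
  then show ?thesis by blast
qed

lemma (in category) ex_pushout:
  assumes inf: "infinite (UNIV :: 'u set)" and comp: "cocomplete_cat TYPE('u) C"
    and f: "f \<in> hom C A B" and g: "g \<in> hom C A D"
  shows "\<exists>P i j. is_pushout C f g P i j"
proof -
  obtain e :: "nat \<Rightarrow> 'u" where e: "inj e" using inf infinite_countable_subset by blast
  note [simp] = inj_eq[OF e] homD[OF f] homD[OF g]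
  define Fo where "Fo = (\<lambda>x. if x = e 0 then B else if x = e 1 then D else A)"
  define Fm where "Fm = (\<lambda>x. if x = e 3 then f else if x = e 4 then g else idn C (Fo x))"
  have "small_cat (span_index e)"
    by (rule small_catI[OF inf category_span_index[OF e]]) (simp add: span_index_def)
  moreover have "is_functor (span_index e) C Fo Fm"
    by (auto simp: is_functor_def span_index_def Fo_def Fm_def hom_def)
  ultimately obtain L \<iota> where L: "is_colimit (span_index e) C Fo Fm L \<iota>"
    using comp unfolding cocomplete_cat_def by blast
  then have cocone: "is_cocone (span_index e) C Fo Fm L \<iota>" by (simp add: is_colimit_def)
  then have \<iota>: "\<iota> (e 0) \<in> hom C B L" "\<iota> (e 1) \<in> hom C D L" "\<iota> (e 2) \<in> hom C A L"
    and eq: "\<iota> (e 0) \<cdot> f = \<iota> (e 2)" "\<iota> (e 1) \<cdot> g = \<iota> (e 2)"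
    by (auto simp: is_cocone_def span_index_def Fo_def Fm_def)
  note [simp] = homD[OF \<iota>(1)] homD[OF \<iota>(2)] homD[OF \<iota>(3)]
  have "is_pushout C f g L (\<iota> (e 0)) (\<iota> (e 1))"
    unfolding is_pushout_def
  proof (intro conjI allI ballI impI)
    fix M a b
    assume "a \<in> hom C (tgt C f) M" "b \<in> hom C (tgt C g) M" and ab: "a \<cdot> f = b \<cdot> g"
    then have a: "a \<in> hom C B M" and b: "b \<in> hom C D M" by simp_all
    note [simp] = homD[OF a] homD[OF b]
    have "is_cocone (span_index e) C Fo Fm M (\<lambda>x. if x = e 0 then a else if x = e 1 then b else a \<cdot> f)"
      by (auto simp: is_cocone_def span_index_def Fo_def Fm_def hom_def ab)
    then have "\<exists>!h. h \<in> hom C L M \<and> (\<forall>j\<in>obj (span_index e). h \<cdot> \<iota> j =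
        (if j = e 0 then a else if j = e 1 then b else a \<cdot> f))"
      using L unfolding is_colimit_def by blast
    moreover have "(h \<in> hom C L M \<and> (\<forall>j\<in>obj (span_index e). h \<cdot> \<iota> j =
        (if j = e 0 then a else if j = e 1 then b else a \<cdot> f))) \<longleftrightarrow>
      (h \<in> hom C L M \<and> h \<cdot> \<iota> (e 0) = a \<and> h \<cdot> \<iota> (e 1) = b)" for h
      by (auto simp: span_index_def hom_def simp flip: eq(1))
    ultimately show "\<exists>!h. h \<in> hom C L M \<and> h \<cdot> \<iota> (e 0) = a \<and> h \<cdot> \<iota> (e 1) = b"
      by simp
  qed (use \<iota> eq in simp_all)
  then show ?thesis by blast
qed

lemma is_pullback_commute: "is_pullback C f g P p q \<Longrightarrow> is_pullback C g f P q p"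
  unfolding is_pullback_def by (auto simp: eq_commute[of "g \<cdot>\<^bsub>C\<^esub> _"]) (metis)+

lemma is_pushout_commute: "is_pushout C f g P i j \<Longrightarrow> is_pushout C g f P j i"
  unfolding is_pushout_def by (auto simp: eq_commute[of "_ \<cdot>\<^bsub>C\<^esub> g"]) (metis)+

text \<open>Over a terminal object every square commutes, so the compatibility condition in the universal
  property of the pullback is vacuous.\<close>

lemma (in category) is_product_terminal:
  assumes T: "is_terminal C T" and a: "a \<in> hom C A T" and b: "b \<in> hom C B T"
  shows "is_product C A B P p q \<longleftrightarrow> is_pullback C a b P p q"
proof -
  note [simp] = homD[OF a] homD[OF b]
  have uniq: "x = y" if "x \<in> hom C M T" "y \<in> hom C M T" for x y M
    using T homD(4)[OF that(1)] that unfolding is_terminal_def by blast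
  have 1: "a \<cdot> x = b \<cdot> y" if "x \<in> hom C M A" "y \<in> hom C M B" for x y M
    using uniq cmp_hom[OF that(1) a] cmp_hom[OF that(2) b] by blast
  show ?thesis unfolding is_product_def is_pullback_def using 1 by auto
qed

section \<open>Premodel categories\<close>

text \<open>Completeness and cocompleteness enter the argument through the following finite limits and
  colimits, so the universe of small sets disappears from it.\<close>

locale premodel_cat = category C
  for C :: "('o, 'm) premodel" (structure) +
  assumes cof_anfib: "weak_factorization_system C (cof C) (anfib C)"
    and ancof_fib: "weak_factorization_system C (ancof C) (fib C)"
    and ancof_cof: "f \<in> ancof C \<Longrightarrow> f \<in> cof C"
    and initial: "\<exists>Z. is_initial C Z"
    and terminal: "\<exists>T. is_terminal C T"
    and pullbacks: "\<lbrakk>f \<in> hom C A D; g \<in> hom C B D\<rbrakk> \<Longrightarrow> \<exists>P p q. is_pullback C f g P p q"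
    and pushouts: "\<lbrakk>f \<in> hom C A B; g \<in> hom C A D\<rbrakk> \<Longrightarrow> \<exists>P i j. is_pushout C f g P i j"

lemma premodel_catI:
  assumes "infinite (UNIV :: 'u set)" "premodel_category TYPE('u) C"
  shows "premodel_cat C"
proof -
  interpret category C using assms(2) by (simp add: premodel_category_def)
  show ?thesis
    using assms ex_initial[OF assms(1), of C] ex_terminal[OF assms(1), of C]
      ex_pullback[OF assms(1)] ex_pushout[OF assms(1)]
    by unfold_locales (auto simp: premodel_category_def)
qed

context premodel_cat
begin

lemmas cof_arr = wfs_arr(1)[OF cof_anfib]
  and anfib_arr = wfs_arr(2)[OF cof_anfib]
  and ancof_arr = wfs_arr(1)[OF ancof_fib]
  and fib_arr = wfs_arr(2)[OF ancof_fib]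
  and cof_lift = wfs_lift[OF cof_anfib]
  and ancof_lift = wfs_lift[OF ancof_fib]
  and cof_cmp = wfs_left_cmp[OF cof_anfib]
  and ancof_cmp = wfs_left_cmp[OF ancof_fib]
  and fib_cmp = wfs_right_cmp[OF ancof_fib]

lemma anfib_fib: "p \<in> anfib C \<Longrightarrow> p \<in> fib C"
  by (rule wfs_rightI[OF ancof_fib]) (auto intro: cof_lift ancof_cof anfib_arr)

lemma fibrant_obj: "fibrant C X \<Longrightarrow> X \<in> obj C"
  and cofibrant_obj: "cofibrant C X \<Longrightarrow> X \<in> obj C"
  unfolding fibrant_wrt_def cofibrant_wrt_def using homD by blast+

lemma terminal_fibrant: "is_terminal C T \<Longrightarrow> fibrant C T"
  using idn_hom[of T] wfs_right_idn[OF ancof_fib, of T]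
  unfolding fibrant_wrt_def is_terminal_def by blast

lemma initial_cofibrant: "is_initial C Z \<Longrightarrow> cofibrant C Z"
  using idn_hom[of Z] wfs_left_idn[OF cof_anfib, of Z]
  unfolding cofibrant_wrt_def is_initial_def by blast

lemma fibrant_src: "\<lbrakk>p \<in> fib C; p \<in> hom C X Y; fibrant C Y\<rbrakk> \<Longrightarrow> fibrant C X"
  unfolding fibrant_wrt_def using fib_cmp cmp_hom by blast

lemma cofibrant_tgt: "\<lbrakk>i \<in> cof C; i \<in> hom C A B; cofibrant C A\<rbrakk> \<Longrightarrow> cofibrant C B"
  unfolding cofibrant_wrt_def using cof_cmp cmp_hom by blast

lemma acyclic_cof_cof: "i \<in> acyclic_cof C \<Longrightarrow> i \<in> cof C"
  by (simp add: acyclic_cof_def)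

lemma acyclic_cof_lift:
  "\<lbrakk>i \<in> acyclic_cof C; p \<in> fib C; p \<in> hom C X Y; fibrant C Y\<rbrakk> \<Longrightarrow> has_lift C i p"
  unfolding acyclic_cof_def using fibrant_src homD by blast

lemma acyclic_cofI:
  assumes "i \<in> cof C"
    and "\<And>p X Y. \<lbrakk>p \<in> fib C; p \<in> hom C X Y; fibrant C X; fibrant C Y\<rbrakk> \<Longrightarrow> has_lift C i p"
  shows "i \<in> acyclic_cof C"
  using assms arr_hom fib_arr unfolding acyclic_cof_def by blast

lemma ancof_acyclic_cof: "i \<in> ancof C \<Longrightarrow> i \<in> acyclic_cof C"
  by (rule acyclic_cofI) (auto intro: ancof_cof ancof_lift)

lemma acyclic_cof_cmp:
  assumes "i \<in> acyclic_cof C" "j \<in> acyclic_cof C" "i \<in> hom C A B" "j \<in> hom C B D"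
  shows "j \<cdot> i \<in> acyclic_cof C"
  by (rule acyclic_cofI)
    (use assms in \<open>auto intro: cof_cmp acyclic_cof_cof has_lift_cmp_left acyclic_cof_lift fib_arr\<close>)

lemma anfib_acyclic_fib: "p \<in> anfib C \<Longrightarrow> p \<in> acyclic_fib C"
  unfolding acyclic_fib_def using anfib_fib cof_lift by blast

lemma acyclic_fib_fib: "p \<in> acyclic_fib C \<Longrightarrow> p \<in> fib C"
  by (simp add: acyclic_fib_def)

lemma acyclic_fib_lift:
  "\<lbrakk>p \<in> acyclic_fib C; i \<in> cof C; i \<in> hom C A B; cofibrant C A\<rbrakk> \<Longrightarrow> has_lift C i p"
  unfolding acyclic_fib_def using cofibrant_tgt homD by blast

lemma acyclic_fibI:
  assumes "p \<in> fib C"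
    and "\<And>i A B. \<lbrakk>i \<in> cof C; i \<in> hom C A B; cofibrant C A; cofibrant C B\<rbrakk> \<Longrightarrow> has_lift C i p"
  shows "p \<in> acyclic_fib C"
  using assms arr_hom cof_arr unfolding acyclic_fib_def by blast

lemma fibrant_extension:
  assumes "fibrant C X" "i \<in> acyclic_cof C" "i \<in> hom C A B" "u \<in> hom C A X"
  obtains v where "v \<in> hom C B X" "v \<cdot> i = u"
proof -
  obtain T t where T: "is_terminal C T" and t: "t \<in> hom C X T" "t \<in> fib C"
    using assms(1) unfolding fibrant_wrt_def by blast
  obtain b where b: "b \<in> hom C B T"
    using T homD(5)[OF assms(3)] unfolding is_terminal_def by blast
  have "t \<cdot> u = b \<cdot> i"
    using T homD(4)[OF assms(3)] cmp_hom[OF assms(4) t(1)] cmp_hom[OF assms(3) b]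
    unfolding is_terminal_def by blast
  with has_liftE[OF acyclic_cof_lift[OF assms(2) t(2,1) terminal_fibrant[OF T]] assms(3) t(1)
      assms(4) b]
  show ?thesis using that by blast
qed

lemma cofibrant_lift:
  assumes "cofibrant C A" "p \<in> anfib C" "p \<in> hom C X Y" "v \<in> hom C A Y"
  obtains u where "u \<in> hom C A X" "p \<cdot> u = v"
proof -
  obtain Z z where Z: "is_initial C Z" and z: "z \<in> hom C Z A" "z \<in> cof C"
    using assms(1) unfolding cofibrant_wrt_def by blast
  obtain x where x: "x \<in> hom C Z X"
    using Z homD(4)[OF assms(3)] unfolding is_initial_def by blast
  have "p \<cdot> x = v \<cdot> z"
    using Z homD(5)[OF assms(3)] cmp_hom[OF x assms(3)] cmp_hom[OF z(1) assms(4)]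
    unfolding is_initial_def by blast
  with has_liftE[OF cof_lift[OF z(2) assms(2)] z(1) assms(3) x assms(4)]
  show ?thesis using that by blast
qed

lemma fibrant_replacement:
  assumes "X \<in> obj C"
  obtains X' j where "j \<in> ancof C" "j \<in> hom C X X'" "fibrant C X'"
proof -
  obtain T where T: "is_terminal C T" using terminal ..
  then obtain t where t: "t \<in> hom C X T" using assms unfolding is_terminal_def by blast
  from wfs_factor[OF ancof_fib t] show ?thesis
    using that fibrant_src terminal_fibrant[OF T] by metis
qed

lemma cofibrant_replacement:
  assumes "X \<in> obj C"
  obtains X' \<pi> where "\<pi> \<in> anfib C" "\<pi> \<in> hom C X' X" "cofibrant C X'"
proof -
  obtain Z where Z: "is_initial C Z" using initial ..
  then obtain z where z: "z \<in> hom C Z X" using assms unfolding is_initial_def by blast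
  from wfs_factor[OF cof_anfib z] show ?thesis
    using that cofibrant_tgt initial_cofibrant[OF Z] by metis
qed

lemma pullback_fibrant:
  assumes "is_pullback C f g P p q" "f \<in> fib C" "g \<in> hom C B D" "fibrant C B"
  shows "fibrant C P"
proof -
  have "f \<in> hom C (src C f) D"
    using assms(1,3) by (auto simp: is_pullback_def hom_def)
  from pullbackD(2)[OF assms(1) this assms(3)] show ?thesis
    using fibrant_src wfs_right_pullback[OF ancof_fib assms(2,1)] assms(4) by blast
qed

lemma pushout_cofibrant:
  assumes "is_pushout C f g P i j" "f \<in> cof C" "g \<in> hom C A D" "cofibrant C D"
  shows "cofibrant C P"
proof -
  have "f \<in> hom C A (tgt C f)"
    using assms(1,3) by (auto simp: is_pushout_def hom_def)
  from pushoutD(2)[OF assms(1) this assms(3)] show ?thesis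
    using cofibrant_tgt wfs_left_pushout[OF cof_anfib assms(2,1)] assms(4) by blast
qed

section \<open>Cylinders, path objects and homotopies\<close>

text \<open>An absolute strong path object is a relative one over the terminal object, so the lifting
  property below covers both kinds.\<close>

lemma has_strong_path_iff_relative:
  assumes "is_terminal C T" "t \<in> hom C X T"
  shows "has_strong_path C X \<longleftrightarrow> has_relative_strong_path C t"
  using is_product_terminal[OF assms(1,2,2)] homD(2)[OF assms(2)]
  unfolding has_strong_path_def has_relative_strong_path_def by simp

text \<open>The path object is fibred over a pullback that is fibrant, so acyclic cofibrations lift against
  its projection to the pullback. Split into the two components \<open>d0\<close>, \<open>d1\<close>, this says that a pair
  of maps that agree over \<open>Y\<close> lifts to the path object as soon as it does so on the source of an
  acyclic cofibration. All later uses of path objects go through this property.\<close>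

lemma relative_strong_pathE:
  assumes path: "has_relative_strong_path C f" and f: "f \<in> hom C X Y" "f \<in> fib C"
    and Y: "fibrant C Y"
  obtains P s d0 d1 where "s \<in> hom C X P" "d0 \<in> hom C P X" "d1 \<in> hom C P X"
    "d0 \<cdot> s = idn C X" "d1 \<cdot> s = idn C X" "d0 \<in> acyclic_fib C" "f \<cdot> d0 = f \<cdot> d1"
    "\<And>A B i w x y. \<lbrakk>i \<in> acyclic_cof C; i \<in> hom C A B; w \<in> hom C A P; x \<in> hom C B X; y \<in> hom C B X;
      f \<cdot> x = f \<cdot> y; d0 \<cdot> w = x \<cdot> i; d1 \<cdot> w = y \<cdot> i\<rbrakk>
      \<Longrightarrow> \<exists>h\<in>hom C B P. h \<cdot> i = w \<and> d0 \<cdot> h = x \<and> d1 \<cdot> h = y"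
proof -
  obtain Q p0 p1 d P s e where Q: "is_pullback C f f Q p0 p1" and d: "d \<in> hom C X Q"
    and pd: "p0 \<cdot> d = idn C X" "p1 \<cdot> d = idn C X" and s: "s \<in> hom C X P" and e: "e \<in> hom C P Q"
    and es: "e \<cdot> s = d" and e_fib: "e \<in> fib C" and d0: "p0 \<cdot> e \<in> acyclic_fib C"
    using path homD[OF f(1)] unfolding has_relative_strong_path_def by auto
  note p = pullbackD[OF Q f(1) f(1)]
  note [simp] = homD[OF f(1)] homD[OF d] homD[OF s] homD[OF e] homD[OF p(1)] homD[OF p(2)]
  have "fibrant C X" using fibrant_src f Y by blast
  then have Qf: "fibrant C Q" using pullback_fibrant[OF Q f(2,1)] by blast
  show ?thesis
  proof (rule that[of s P "p0 \<cdot> e" "p1 \<cdot> e"])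
    show "f \<cdot> (p0 \<cdot> e) = f \<cdot> (p1 \<cdot> e)" using whisker[OF p(3), of e] by simp
    fix A B i w x y
    assume i: "i \<in> acyclic_cof C" "i \<in> hom C A B" and w: "w \<in> hom C A P" and x: "x \<in> hom C B X"
      and y: "y \<in> hom C B X" and xy: "f \<cdot> x = f \<cdot> y" and eq: "p0 \<cdot> e \<cdot> w = x \<cdot> i" "p1 \<cdot> e \<cdot> w = y \<cdot> i"
    note [simp] = homD[OF i(2)] homD[OF w] homD[OF x] homD[OF y]
    obtain k where k: "k \<in> hom C B Q" "p0 \<cdot> k = x" "p1 \<cdot> k = y"
      using pullback_univ[OF Q f(1) f(1) x y xy] .
    note [simp] = homD[OF k(1)]
    have ki: "e \<cdot> w = k \<cdot> i"
      by (rule pullback_eq[OF Q f(1) f(1), of _ A])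
        (use eq in \<open>simp_all add: homI whisker[OF k(2)] whisker[OF k(3)]\<close>)
    obtain h where h: "h \<in> hom C B P" "h \<cdot> i = w" "e \<cdot> h = k"
      using has_liftE[OF acyclic_cof_lift[OF i(1) e_fib e Qf] i(2) e w k(1) ki] .
    note [simp] = homD[OF h(1)]
    show "\<exists>h\<in>hom C B P. h \<cdot> i = w \<and> p0 \<cdot> e \<cdot> h = x \<and> p1 \<cdot> e \<cdot> h = y"
      by (rule bexI[OF _ h(1)]) (simp add: h k)
  qed (simp_all add: homI s d0 es pd)
qed

text \<open>These are the cofibrations for which a weak model category provides relative cylinders; they
  also serve as the test maps that detect equivalences.\<close>

definition test_cof :: "'m \<Rightarrow> bool" where
  "test_cof a \<longleftrightarrow> a \<in> cof C \<and> cofibrant C (src C a) \<and> fibrant C (tgt C a)"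

text \<open>A relative strong cylinder \<open>I\<close> that is moreover fibrant, since \<open>test_cof j\<close> includes fibrancy of
  the target of \<open>j\<close>.\<close>

definition relative_cylinder :: "'m \<Rightarrow> 'o \<Rightarrow> 'm \<Rightarrow> 'm \<Rightarrow> 'o \<Rightarrow> 'm \<Rightarrow> 'm \<Rightarrow> bool" where
  "relative_cylinder a Q i0 i1 I j \<sigma> \<longleftrightarrow>
     is_pushout C a a Q i0 i1 \<and> j \<in> hom C Q I \<and> test_cof j \<and> j \<cdot> i0 \<in> acyclic_cof C \<and>
     \<sigma> \<in> hom C I (tgt C a) \<and> \<sigma> \<cdot> (j \<cdot> i0) = idn C (tgt C a) \<and> \<sigma> \<cdot> (j \<cdot> i1) = idn C (tgt C a)"

text \<open>Homotopy relative to the source of \<open>a\<close>. The cylinder may vary: any other one would do, but that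
  rests on path objects of the target (see \<open>right_homotopic_imp_homotopic\<close>).\<close>

definition homotopic :: "'m \<Rightarrow> 'm \<Rightarrow> 'm \<Rightarrow> bool" where
  "homotopic a x y \<longleftrightarrow> (\<exists>Q i0 i1 I j \<sigma>. relative_cylinder a Q i0 i1 I j \<sigma> \<and>
     (\<exists>h\<in>hom C I (tgt C x). h \<cdot> (j \<cdot> i0) = x \<and> h \<cdot> (j \<cdot> i1) = y))"

text \<open>The cylinder object can be made fibrant by composing with a fibrant replacement, because its
  target is fibrant. Then the inclusion of its two ends is again a test cofibration.\<close>

lemma ex_relative_cylinder:
  assumes cyl: "has_relative_strong_cylinder C a" and a: "test_cof a"
  shows "\<exists>Q i0 i1 I j \<sigma>. relative_cylinder a Q i0 i1 I j \<sigma>"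
proof -
  obtain Q i0 i1 d I j q where Q: "is_pushout C a a Q i0 i1" and d: "d \<in> hom C Q (tgt C a)"
    and di: "d \<cdot> i0 = idn C (tgt C a)" "d \<cdot> i1 = idn C (tgt C a)" and j: "j \<in> hom C Q I"
    and q: "q \<in> hom C I (tgt C a)" and qj: "q \<cdot> j = d" and j_cof: "j \<in> cof C"
    and ji: "j \<cdot> i0 \<in> acyclic_cof C"
    using cyl unfolding has_relative_strong_cylinder_def by blast
  have a': "a \<in> cof C" "cofibrant C (src C a)" "fibrant C (tgt C a)"
    using a by (simp_all add: test_cof_def)
  note ah = arr_hom[OF cof_arr[OF a'(1)]]
  note po = pushoutD[OF Q ah ah]
  have Qc: "cofibrant C Q"
    using pushout_cofibrant[OF Q a'(1) ah] cofibrant_tgt[OF a'(1) ah a'(2)] .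
  obtain r I' where r: "r \<in> ancof C" "r \<in> hom C I I'" and I': "fibrant C I'"
    using fibrant_replacement[OF homD(5)[OF j]] by metis
  obtain \<sigma> where \<sigma>: "\<sigma> \<in> hom C I' (tgt C a)" "\<sigma> \<cdot> r = q"
    using fibrant_extension[OF a'(3) ancof_acyclic_cof[OF r(1)] r(2) q] .
  note [simp] = homD[OF po(1)] homD[OF po(2)] homD[OF d] homD[OF j] homD[OF q] homD[OF r(2)]
    homD[OF \<sigma>(1)]
  have "r \<cdot> j \<in> cof C" using cof_cmp[OF j_cof ancof_cof[OF r(1)] j r(2)] .
  moreover have "r \<cdot> (j \<cdot> i0) \<in> acyclic_cof C"
    using acyclic_cof_cmp[OF ji ancof_acyclic_cof[OF r(1)] cmp_hom[OF po(1) j] r(2)] .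
  moreover have "\<sigma> \<cdot> (r \<cdot> (j \<cdot> x)) = d \<cdot> x" if "x \<in> arr C" "tgt C x = Q" for x
    using that by (simp add: whisker[OF \<sigma>(2)] whisker[OF qj])
  ultimately have "relative_cylinder a Q i0 i1 I' (r \<cdot> j) \<sigma>"
    using Q Qc I' \<sigma>(1) by (simp add: relative_cylinder_def test_cof_def homI di)
  then show ?thesis by blast
qed

lemma test_cofI: "\<lbrakk>a \<in> cof C; a \<in> hom C A B; cofibrant C A; fibrant C B\<rbrakk> \<Longrightarrow> test_cof a"
  unfolding test_cof_def using homD by blast

lemma test_cofD:
  assumes "test_cof a" "a \<in> hom C A B"
  shows "a \<in> cof C" "cofibrant C A" "cofibrant C B" "fibrant C B"
  using assms homD(2,3)[OF assms(2)] cofibrant_tgt[of a A B] unfolding test_cof_def by auto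

lemma relative_cylinderD:
  assumes "relative_cylinder a Q i0 i1 I j \<sigma>" "a \<in> hom C A B"
  shows "is_pushout C a a Q i0 i1" "i0 \<in> hom C B Q" "i1 \<in> hom C B Q" "i0 \<cdot> a = i1 \<cdot> a"
    "j \<in> hom C Q I" "test_cof j" "j \<cdot> i0 \<in> acyclic_cof C" "j \<cdot> i0 \<in> hom C B I"
    "\<sigma> \<in> hom C I B" "\<sigma> \<cdot> (j \<cdot> i0) = idn C B" "\<sigma> \<cdot> (j \<cdot> i1) = idn C B"
  using assms pushoutD[of a a Q i0 i1 A B B] cmp_hom[of i0 B Q j I] homD(3)[OF assms(2)]
  unfolding relative_cylinder_def by auto

text \<open>The first projection is anodyne, which for a fibrant object is the acyclicity of a strong path
  object together with core right saturation. Fibrancy over \<open>X \<times> X\<close> is recorded as the joint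
  lifting property of the two projections.\<close>

definition path_object :: "'o \<Rightarrow> 'o \<Rightarrow> 'm \<Rightarrow> 'm \<Rightarrow> 'm \<Rightarrow> bool" where
  "path_object X P s d0 d1 \<longleftrightarrow>
     s \<in> hom C X P \<and> d0 \<in> hom C P X \<and> d1 \<in> hom C P X \<and>
     d0 \<cdot> s = idn C X \<and> d1 \<cdot> s = idn C X \<and> d0 \<in> anfib C \<and>
     (\<forall>A B. \<forall>i\<in>acyclic_cof C \<inter> hom C A B. \<forall>w\<in>hom C A P. \<forall>x\<in>hom C B X. \<forall>y\<in>hom C B X.
        d0 \<cdot> w = x \<cdot> i \<and> d1 \<cdot> w = y \<cdot> i \<longrightarrow>
        (\<exists>h\<in>hom C B P. h \<cdot> i = w \<and> d0 \<cdot> h = x \<and> d1 \<cdot> h = y))"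

lemma path_objectD:
  assumes "path_object X P s d0 d1"
  shows "s \<in> hom C X P" "d0 \<in> hom C P X" "d1 \<in> hom C P X" "d0 \<cdot> s = idn C X" "d1 \<cdot> s = idn C X"
    "d0 \<in> anfib C"
  using assms unfolding path_object_def by blast+

lemma path_object_lift:
  assumes "path_object X P s d0 d1" "i \<in> acyclic_cof C" "i \<in> hom C A B" "w \<in> hom C A P"
    "x \<in> hom C B X" "y \<in> hom C B X" "d0 \<cdot> w = x \<cdot> i" "d1 \<cdot> w = y \<cdot> i"
  obtains h where "h \<in> hom C B P" "h \<cdot> i = w" "d0 \<cdot> h = x" "d1 \<cdot> h = y"
  using assms that unfolding path_object_def by blast

text \<open>Homotopy through a path object of the target, constant on the source of \<open>a\<close>.\<close>

definition right_homotopic :: "'m \<Rightarrow> 'm \<Rightarrow> 'm \<Rightarrow> bool" where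
  "right_homotopic a x y \<longleftrightarrow> (\<exists>P s d0 d1. path_object (tgt C x) P s d0 d1 \<and>
     (\<exists>r\<in>hom C (tgt C a) P. d0 \<cdot> r = x \<and> d1 \<cdot> r = y \<and> r \<cdot> a = s \<cdot> (x \<cdot> a)))"

lemma right_homotopicI:
  assumes "path_object X P s d0 d1" "a \<in> hom C A B" "x \<in> hom C B X" "r \<in> hom C B P"
    "d0 \<cdot> r = x" "d1 \<cdot> r = y" "r \<cdot> a = s \<cdot> (x \<cdot> a)"
  shows "right_homotopic a x y"
  unfolding right_homotopic_def homD(3)[OF assms(2)] homD(3)[OF assms(3)]
  by (rule exI[of _ P], rule exI[of _ s], rule exI[of _ d0], rule exI[of _ d1])
    (use assms in blast)

lemma right_homotopicE:
  assumes "right_homotopic a x y" "a \<in> hom C A B" "x \<in> hom C B X"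
  obtains P s d0 d1 r where "path_object X P s d0 d1" "r \<in> hom C B P"
    "d0 \<cdot> r = x" "d1 \<cdot> r = y" "r \<cdot> a = s \<cdot> (x \<cdot> a)"
  using assms(1) that homD(3)[OF assms(2)] homD(3)[OF assms(3)]
  unfolding right_homotopic_def by metis

text \<open>A homotopical right lifting property. It is the strict lifting property of acyclic fibrations
  with the lower triangle relaxed to a homotopy relative to the source of the test map; unlike a
  condition on homotopy classes it keeps enough control of boundaries to recover strict lifts
  when the map is a fibration.\<close>

definition core_equiv :: "'m \<Rightarrow> bool" where
  "core_equiv f \<longleftrightarrow> f \<in> arr C \<and> fibrant C (src C f) \<and> fibrant C (tgt C f) \<and>
     (\<forall>a u v. test_cof a \<and> u \<in> hom C (src C a) (src C f) \<and> v \<in> hom C (tgt C a) (tgt C f) \<and>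
        f \<cdot> u = v \<cdot> a \<longrightarrow>
        (\<exists>h\<in>hom C (tgt C a) (src C f). h \<cdot> a = u \<and> homotopic a (f \<cdot> h) v))"

lemma core_equivI:
  assumes "f \<in> hom C X Y" "fibrant C X" "fibrant C Y"
    and "\<And>a A B u v. \<lbrakk>test_cof a; a \<in> hom C A B; u \<in> hom C A X; v \<in> hom C B Y; f \<cdot> u = v \<cdot> a\<rbrakk>
      \<Longrightarrow> \<exists>h\<in>hom C B X. h \<cdot> a = u \<and> homotopic a (f \<cdot> h) v"
  shows "core_equiv f"
  using assms(2-) arr_hom cof_arr unfolding core_equiv_def test_cof_def homD(2,3)[OF assms(1)]
  by (blast intro: homD(1)[OF assms(1)])

lemma core_equivE:
  assumes "core_equiv f" "f \<in> hom C X Y" "test_cof a" "a \<in> hom C A B"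
    "u \<in> hom C A X" "v \<in> hom C B Y" "f \<cdot> u = v \<cdot> a"
  obtains h where "h \<in> hom C B X" "h \<cdot> a = u" "homotopic a (f \<cdot> h) v"
  using assms(1,3,5-) that homD(2,3)[OF assms(2)] homD(2,3)[OF assms(4)]
  unfolding core_equiv_def by blast

lemma core_equiv_fibrant:
  assumes "core_equiv f" "f \<in> hom C X Y"
  shows "fibrant C X" "fibrant C Y"
  using assms(1) homD(2,3)[OF assms(2)] unfolding core_equiv_def by auto

lemma homotopicE:
  assumes "homotopic a x y" "a \<in> hom C A B" "x \<in> hom C B X"
  obtains Q i0 i1 I j \<sigma> h where "relative_cylinder a Q i0 i1 I j \<sigma>" "h \<in> hom C I X"
    "h \<cdot> (j \<cdot> i0) = x" "h \<cdot> (j \<cdot> i1) = y"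
  using assms(1) that homD(3)[OF assms(3)] unfolding homotopic_def by blast

lemma homotopicI:
  assumes "relative_cylinder a Q i0 i1 I j \<sigma>" "a \<in> hom C A B" "h \<in> hom C I X"
  shows "homotopic a (h \<cdot> (j \<cdot> i0)) (h \<cdot> (j \<cdot> i1))"
proof -
  note c = relative_cylinderD[OF assms(1,2)]
  have "tgt C (h \<cdot> (j \<cdot> i0)) = X" using homD(3)[OF cmp_hom[OF c(8) assms(3)]] .
  then show ?thesis using assms(1,3) unfolding homotopic_def by blast
qed

lemma homotopic_whisker:
  assumes "homotopic a x y" "a \<in> hom C A B" "x \<in> hom C B X" "g \<in> hom C X Y"
  shows "homotopic a (g \<cdot> x) (g \<cdot> y)"
proof -
  obtain Q i0 i1 I j \<sigma> h where c: "relative_cylinder a Q i0 i1 I j \<sigma>" and h: "h \<in> hom C I X"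
    "h \<cdot> (j \<cdot> i0) = x" "h \<cdot> (j \<cdot> i1) = y"
    using homotopicE[OF assms(1-3)] .
  note c' = relative_cylinderD[OF c assms(2)]
  note [simp] = homD[OF h(1)] homD[OF assms(4)] homD[OF c'(2)] homD[OF c'(3)] homD[OF c'(5)]
  show ?thesis using homotopicI[OF c assms(2) cmp_hom[OF h(1) assms(4)]] by (simp add: h(2,3))
qed

lemma homotopic_tgt:
  assumes "homotopic a x y" "a \<in> hom C A B" "x \<in> hom C B X"
  shows "y \<in> hom C B X" "x \<cdot> a = y \<cdot> a"
proof -
  obtain Q i0 i1 I j \<sigma> h where cyl: "relative_cylinder a Q i0 i1 I j \<sigma>" and h: "h \<in> hom C I X"
    "h \<cdot> (j \<cdot> i0) = x" "h \<cdot> (j \<cdot> i1) = y"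
    using homotopicE[OF assms] .
  note c = relative_cylinderD[OF cyl assms(2)]
  note [simp] = homD[OF assms(2)] homD[OF c(2)] homD[OF c(3)] homD[OF c(5)] homD[OF h(1)]
  show "y \<in> hom C B X" using cmp_hom[OF cmp_hom[OF c(3,5)] h(1)] h(3) by simp
  show "x \<cdot> a = y \<cdot> a" by (simp add: c(4) flip: h(2,3))
qed

end

locale core_saturated_premodel = premodel_cat C
  for C :: "('o, 'm) premodel" (structure) +
  assumes cylinder: "\<lbrakk>f \<in> cof C; cofibrant C (src C f); fibrant C (tgt C f)\<rbrakk>
      \<Longrightarrow> has_relative_strong_cylinder C f"
    and relative_path: "\<lbrakk>f \<in> fib C; cofibrant C (src C f); fibrant C (tgt C f)\<rbrakk>
      \<Longrightarrow> has_relative_strong_path C f"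
    and path: "fibrant C X \<Longrightarrow> has_strong_path C X"
    and saturated: "\<lbrakk>p \<in> acyclic_fib C; p \<in> hom C X Y; fibrant C Y\<rbrakk> \<Longrightarrow> p \<in> anfib C"
begin

lemma obtain_cylinder:
  assumes "test_cof a"
  obtains Q i0 i1 I j \<sigma> where "relative_cylinder a Q i0 i1 I j \<sigma>"
  using assms ex_relative_cylinder cylinder unfolding test_cof_def by metis

lemma ex_path_object:
  assumes "fibrant C X"
  shows "\<exists>P s d0 d1. path_object X P s d0 d1"
proof -
  obtain T t where T: "is_terminal C T" and t: "t \<in> hom C X T" "t \<in> fib C"
    using assms unfolding fibrant_wrt_def by blast
  have uniq: "t \<cdot> x = t \<cdot> y" if "x \<in> hom C B X" "y \<in> hom C B X" for x y B
    using T homD(4)[OF that(1)] cmp_hom[OF that(1) t(1)] cmp_hom[OF that(2) t(1)]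
    unfolding is_terminal_def by blast
  obtain P s d0 d1 where P: "s \<in> hom C X P" "d0 \<in> hom C P X" "d1 \<in> hom C P X"
    "d0 \<cdot> s = idn C X" "d1 \<cdot> s = idn C X" "d0 \<in> acyclic_fib C"
    and lift: "\<And>A B i w x y. \<lbrakk>i \<in> acyclic_cof C; i \<in> hom C A B; w \<in> hom C A P; x \<in> hom C B X;
      y \<in> hom C B X; t \<cdot> x = t \<cdot> y; d0 \<cdot> w = x \<cdot> i; d1 \<cdot> w = y \<cdot> i\<rbrakk>
      \<Longrightarrow> \<exists>h\<in>hom C B P. h \<cdot> i = w \<and> d0 \<cdot> h = x \<and> d1 \<cdot> h = y"
    using relative_strong_pathE[OF iffD1[OF has_strong_path_iff_relative[OF T t(1)] path[OF assms]] t
      terminal_fibrant[OF T]] by metis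
  have "path_object X P s d0 d1" unfolding path_object_def
    using P saturated[OF P(6,2) assms] lift uniq by blast
  then show ?thesis by blast
qed

text \<open>The map from the boundary \<open>Q\<close> of the cylinder to the path object that is constant at one end and
  \<open>r\<close> at the other extends over the whole cylinder with constant first component, because the
  first projection is anodyne. Its second component is the homotopy. This works for every cylinder
  and starts from any path object, so right homotopies serve to compare different cylinders.\<close>

lemma right_homotopic_imp_homotopic:
  assumes R: "right_homotopic a x y" and a: "test_cof a" "a \<in> hom C A B" and x: "x \<in> hom C B X"
  shows "homotopic a x y"
proof -
  obtain P s d0 d1 r where P: "path_object X P s d0 d1" and r: "r \<in> hom C B P"
    "d0 \<cdot> r = x" "d1 \<cdot> r = y" "r \<cdot> a = s \<cdot> (x \<cdot> a)"
    using right_homotopicE[OF R a(2) x] .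
  obtain Q i0 i1 I j \<sigma> where cyl: "relative_cylinder a Q i0 i1 I j \<sigma>" using obtain_cylinder[OF a(1)] .
  note c = relative_cylinderD[OF cyl a(2)]
  note p = path_objectD[OF P]
  note [simp] = homD[OF a(2)] homD[OF x] homD[OF r(1)] homD[OF p(1)] homD[OF p(2)] homD[OF p(3)]
    homD[OF c(2)] homD[OF c(3)] homD[OF c(5)] homD[OF c(9)]
  have sx: "s \<cdot> x \<in> hom C B P" by (simp add: homI)
  have "(s \<cdot> x) \<cdot> a = r \<cdot> a" by (simp add: r(4))
  then obtain w where w: "w \<in> hom C Q P" "w \<cdot> i0 = s \<cdot> x" "w \<cdot> i1 = r"
    using pushout_univ[OF c(1) a(2) a(2) sx r(1)] by blast
  note [simp] = homD[OF w(1)]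
  have "d0 \<cdot> w = x \<cdot> \<sigma> \<cdot> j"
    by (rule pushout_eq[OF c(1) a(2) a(2), of _ X])
      (simp_all add: homI w(2,3) whisker[OF p(4)] r(2) c(10,11))
  then obtain h where h: "h \<in> hom C I P" "h \<cdot> j = w" "d0 \<cdot> h = x \<cdot> \<sigma>"
    using has_liftE[OF cof_lift[OF _ p(6)] c(5) p(2) w(1) cmp_hom[OF c(9) x]] test_cofD(1)[OF c(6,5)]
    by metis
  note [simp] = homD[OF h(1)]
  have "d1 \<cdot> h \<cdot> (j \<cdot> i0) = x" "d1 \<cdot> h \<cdot> (j \<cdot> i1) = y"
    by (simp_all add: whisker[OF h(2)] w(2,3) whisker[OF p(5)] r(3))
  with homotopicI[OF cyl a(2) cmp_hom[OF h(1) p(3)]] show ?thesis by simp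
qed

text \<open>Three sides \<open>h : y \<sim> x\<close>, \<open>r : y \<sim> z\<close> and the constant homotopy at \<open>z\<close> of a square of homotopies
  have a fourth side: the cylinder carries \<open>h\<close> and the constant homotopy, the path object carries
  \<open>r\<close>, and the end \<open>j \<cdot> i0\<close> of the cylinder is an acyclic cofibration. Symmetry and transitivity
  of \<open>homotopic\<close> are formal consequences.\<close>

lemma right_homotopic_transfer:
  assumes L: "homotopic a y x" and R: "right_homotopic a y z" and a: "test_cof a" "a \<in> hom C A B"
    and x: "y \<in> hom C B X" "z \<in> hom C B X"
  shows "right_homotopic a x z"
proof -
  obtain P s d0 d1 r where P: "path_object X P s d0 d1" and r: "r \<in> hom C B P"
    "d0 \<cdot> r = y" "d1 \<cdot> r = z" "r \<cdot> a = s \<cdot> (y \<cdot> a)"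
    using right_homotopicE[OF R a(2) x(1)] .
  obtain Q i0 i1 I j \<sigma> h where cyl: "relative_cylinder a Q i0 i1 I j \<sigma>" and h: "h \<in> hom C I X"
    "h \<cdot> (j \<cdot> i0) = y" "h \<cdot> (j \<cdot> i1) = x"
    using homotopicE[OF L a(2) x(1)] .
  note c = relative_cylinderD[OF cyl a(2)]
  note p = path_objectD[OF P]
  note [simp] = homD[OF a(2)] homD[OF x(1)] homD[OF x(2)] homD[OF r(1)] homD[OF p(1)] homD[OF p(2)]
    homD[OF p(3)] homD[OF c(2)] homD[OF c(3)] homD[OF c(5)] homD[OF c(9)] homD[OF h(1)]
  obtain l where l: "l \<in> hom C I P" "l \<cdot> (j \<cdot> i0) = r" "d0 \<cdot> l = h" "d1 \<cdot> l = z \<cdot> \<sigma>"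
    by (rule path_object_lift[OF P c(7,8) r(1) h(1) cmp_hom[OF c(9) x(2)]])
      (simp_all add: r h c(10))
  note [simp] = homD[OF l(1)]
  have xa: "x \<cdot> a = y \<cdot> a" by (simp add: c(4) flip: h(2,3))
  have "d0 \<cdot> (l \<cdot> (j \<cdot> i1)) = x" "d1 \<cdot> (l \<cdot> (j \<cdot> i1)) = z"
    by (simp_all add: whisker[OF l(3)] whisker[OF l(4)] h(3) c(11))
  moreover have "l \<cdot> (j \<cdot> i1) \<cdot> a = s \<cdot> (x \<cdot> a)"
    using r(4) by (simp add: xa flip: l(2) c(4))
  moreover have "l \<cdot> (j \<cdot> i1) \<in> hom C B P" by (simp add: homI)
  moreover have "x \<in> hom C B X" by (simp add: homI flip: h(3))
  ultimately show ?thesis using right_homotopicI[OF P a(2)] by blast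
qed

lemma right_homotopic_refl:
  assumes "test_cof a" "a \<in> hom C A B" "x \<in> hom C B X" "fibrant C X"
  shows "right_homotopic a x x"
proof -
  obtain P s d0 d1 where P: "path_object X P s d0 d1" using ex_path_object[OF assms(4)] by blast
  note p = path_objectD[OF P]
  note [simp] = homD[OF assms(2)] homD[OF assms(3)] homD[OF p(1)] homD[OF p(2)] homD[OF p(3)]
  have "s \<cdot> x \<in> hom C B P" "d0 \<cdot> (s \<cdot> x) = x" "d1 \<cdot> (s \<cdot> x) = x" "(s \<cdot> x) \<cdot> a = s \<cdot> (x \<cdot> a)"
    by (simp_all add: homI whisker[OF p(4)] whisker[OF p(5)])
  then show ?thesis using right_homotopicI[OF P assms(2,3)] by blast
qed

lemma homotopic_refl:
  assumes "test_cof a" "a \<in> hom C A B" "x \<in> hom C B X" "fibrant C X"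
  shows "homotopic a x x"
  by (rule right_homotopic_imp_homotopic[OF right_homotopic_refl[OF assms] assms(1-3)])

lemma homotopic_imp_right_homotopic:
  assumes "homotopic a x y" "test_cof a" "a \<in> hom C A B" "x \<in> hom C B X" "fibrant C X"
  shows "right_homotopic a y x"
  by (rule right_homotopic_transfer[OF assms(1) right_homotopic_refl[OF assms(2-5)] assms(2-4,4)])

lemma homotopic_sym:
  assumes "homotopic a x y" "test_cof a" "a \<in> hom C A B" "x \<in> hom C B X" "fibrant C X"
  shows "homotopic a y x"
  by (rule right_homotopic_imp_homotopic[OF homotopic_imp_right_homotopic[OF assms] assms(2,3)
      homotopic_tgt(1)[OF assms(1,3,4)]])

lemma homotopic_trans:
  assumes "homotopic a x y" "homotopic a y z" "test_cof a" "a \<in> hom C A B" "x \<in> hom C B X"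
    "fibrant C X"
  shows "homotopic a x z"
proof -
  note y = homotopic_tgt(1)[OF assms(1,4,5)]
  note z = homotopic_tgt(1)[OF assms(2,4) y]
  note zy = homotopic_sym[OF assms(2-4) y assms(6)]
  note yx = homotopic_sym[OF assms(1,3-6)]
  have "right_homotopic a x z"
    by (rule right_homotopic_transfer[OF yx homotopic_imp_right_homotopic[OF zy assms(3,4) z assms(6)]
          assms(3,4) y z])
  then show ?thesis by (rule right_homotopic_imp_homotopic[OF _ assms(3-5)])
qed

section \<open>Equivalences between fibrant objects\<close>

lemma core_equiv_anfib:
  assumes p: "p \<in> anfib C" "p \<in> hom C X Y" and Y: "fibrant C Y"
  shows "core_equiv p"
proof (rule core_equivI[OF p(2) fibrant_src[OF anfib_fib[OF p(1)] p(2) Y] Y])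
  fix a A B u v
  assume a: "test_cof a" "a \<in> hom C A B" and u: "u \<in> hom C A X" and v: "v \<in> hom C B Y"
    and eq: "p \<cdot> u = v \<cdot> a"
  from has_liftE[OF cof_lift[OF test_cofD(1)[OF a] p(1)] a(2) p(2) u v eq]
  show "\<exists>h\<in>hom C B X. h \<cdot> a = u \<and> homotopic a (p \<cdot> h) v"
    using homotopic_refl[OF a v Y] by metis
qed

lemma core_equiv_idn: "fibrant C X \<Longrightarrow> core_equiv (idn C X)"
  using core_equiv_anfib wfs_right_idn[OF cof_anfib] idn_hom fibrant_obj by blast

text \<open>Such a map has a retraction \<open>r\<close>, and a lift against the path object of \<open>Y\<close> contracts \<open>i \<cdot> r\<close> to the
  identity relative to \<open>X\<close>. The filler of a square is then \<open>r \<cdot> v\<close>.\<close>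

lemma core_equiv_ancof:
  assumes i: "i \<in> ancof C" "i \<in> hom C X Y" and X: "fibrant C X" and Y: "fibrant C Y"
  shows "core_equiv i"
proof (rule core_equivI[OF i(2) X Y])
  note acyc = ancof_acyclic_cof[OF i(1)]
  obtain r where r: "r \<in> hom C Y X" "r \<cdot> i = idn C X"
    using fibrant_extension[OF X acyc i(2) idn_hom[OF fibrant_obj[OF X]]] .
  obtain P s d0 d1 where P: "path_object Y P s d0 d1" using ex_path_object[OF Y] by blast
  note p = path_objectD[OF P]
  note [simp] = homD[OF i(2)] homD[OF r(1)] homD[OF p(1)] homD[OF p(2)] homD[OF p(3)]
  obtain l where l: "l \<in> hom C Y P" "l \<cdot> i = s \<cdot> i" "d0 \<cdot> l = i \<cdot> r" "d1 \<cdot> l = idn C Y"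
    by (rule path_object_lift[OF P acyc i(2) cmp_hom[OF i(2) p(1)] cmp_hom[OF r(1) i(2)]
          idn_hom[OF fibrant_obj[OF Y]]])
      (simp_all add: whisker[OF p(4)] whisker[OF p(5)] r(2))
  note [simp] = homD[OF l(1)]
  fix a A B u v
  assume a: "test_cof a" "a \<in> hom C A B" and u: "u \<in> hom C A X" and v: "v \<in> hom C B Y"
    and eq: "i \<cdot> u = v \<cdot> a"
  note [simp] = homD[OF a(2)] homD[OF u] homD[OF v]
  have rva: "r \<cdot> (v \<cdot> a) = u" by (simp add: whisker[OF r(2)] flip: eq)
  have irv: "i \<cdot> (r \<cdot> v) \<in> hom C B Y" by (simp add: homI)
  have "right_homotopic a (i \<cdot> (r \<cdot> v)) v"
    by (rule right_homotopicI[OF P a(2) irv cmp_hom[OF v l(1)]])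
      (simp_all add: whisker[OF l(3)] whisker[OF l(4)] rva whisker[OF l(2)] whisker[OF r(2)] flip: eq)
  then have "homotopic a (i \<cdot> (r \<cdot> v)) v"
    by (rule right_homotopic_imp_homotopic[OF _ a irv])
  with rva show "\<exists>h\<in>hom C B X. h \<cdot> a = u \<and> homotopic a (i \<cdot> h) v"
    by (intro bexI[of _ "r \<cdot> v"]) (simp_all add: homI)
qed

text \<open>A homotopy in the target of a fibration lifts along the acyclic cofibration that includes one
  end of the cylinder, so the solution up to homotopy can be corrected to a strict one.\<close>

lemma core_equiv_fib_test_lift:
  assumes p: "core_equiv p" "p \<in> fib C" "p \<in> hom C X Y" and a: "test_cof a" "a \<in> hom C A B"
  shows "has_lift C a p"
proof (rule has_liftI[OF a(2) p(3)])
  fix u v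
  assume u: "u \<in> hom C A X" and v: "v \<in> hom C B Y" and eq: "p \<cdot> u = v \<cdot> a"
  obtain h where h: "h \<in> hom C B X" "h \<cdot> a = u" "homotopic a (p \<cdot> h) v"
    using core_equivE[OF p(1,3) a u v eq] .
  obtain Q i0 i1 I j \<sigma> k where cyl: "relative_cylinder a Q i0 i1 I j \<sigma>" and k: "k \<in> hom C I Y"
    "k \<cdot> (j \<cdot> i0) = p \<cdot> h" "k \<cdot> (j \<cdot> i1) = v"
    using homotopicE[OF h(3) a(2) cmp_hom[OF h(1) p(3)]] .
  note c = relative_cylinderD[OF cyl a(2)]
  obtain l where l: "l \<in> hom C I X" "l \<cdot> (j \<cdot> i0) = h" "p \<cdot> l = k"
    using has_liftE[OF acyclic_cof_lift[OF c(7) p(2,3) core_equiv_fibrant(2)[OF p(1,3)]] c(8) p(3)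
        h(1) k(1) k(2)[symmetric]] .
  note [simp] = homD[OF a(2)] homD[OF p(3)] homD[OF c(2)] homD[OF c(3)] homD[OF c(5)] homD[OF k(1)]
    homD[OF l(1)]
  have "l \<cdot> (j \<cdot> i1) \<in> hom C B X" "p \<cdot> (l \<cdot> (j \<cdot> i1)) = v"
    by (simp_all add: homI whisker[OF l(3)] k(3))
  moreover have "l \<cdot> (j \<cdot> i1) \<cdot> a = u" using h(2) by (simp flip: l(2) c(4))
  ultimately show "\<exists>h\<in>hom C B X. h \<cdot> a = u \<and> p \<cdot> h = v" by blast
qed

text \<open>A square from a cofibration between cofibrant objects extends to a square from a test cofibration:
  replace the target by a fibrant object, to which \<open>v\<close> extends because \<open>Y\<close> is fibrant.\<close>

lemma core_equiv_fib_anfib: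
  assumes p: "core_equiv p" "p \<in> fib C" "p \<in> hom C X Y"
  shows "p \<in> anfib C"
proof (rule saturated[OF acyclic_fibI[OF p(2)] p(3) core_equiv_fibrant(2)[OF p(1,3)]])
  fix i A B
  assume i: "i \<in> cof C" "i \<in> hom C A B" and A: "cofibrant C A"
  obtain B' j where j: "j \<in> ancof C" "j \<in> hom C B B'" and B': "fibrant C B'"
    using fibrant_replacement[OF homD(5)[OF i(2)]] by metis
  have ji: "j \<cdot> i \<in> cof C" "j \<cdot> i \<in> hom C A B'"
    using cof_cmp[OF i(1) ancof_cof[OF j(1)] i(2) j(2)] cmp_hom[OF i(2) j(2)] .
  show "has_lift C i p"
  proof (rule has_liftI[OF i(2) p(3)])
    fix u v
    assume u: "u \<in> hom C A X" and v: "v \<in> hom C B Y" and eq: "p \<cdot> u = v \<cdot> i"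
    obtain v' where v': "v' \<in> hom C B' Y" "v' \<cdot> j = v"
      using fibrant_extension[OF core_equiv_fibrant(2)[OF p(1,3)] ancof_acyclic_cof[OF j(1)] j(2) v] .
    note [simp] = homD[OF i(2)] homD[OF j(2)] homD[OF v'(1)] homD[OF p(3)]
    have "p \<cdot> u = v' \<cdot> (j \<cdot> i)" by (simp add: eq whisker[OF v'(2)])
    then obtain h where h: "h \<in> hom C B' X" "h \<cdot> (j \<cdot> i) = u" "p \<cdot> h = v'"
      using has_liftE[OF core_equiv_fib_test_lift[OF p test_cofI[OF ji A B'] ji(2)] ji(2) p(3) u v'(1)]
      by metis
    note [simp] = homD[OF h(1)]
    show "\<exists>h\<in>hom C B X. h \<cdot> i = u \<and> p \<cdot> h = v"
      by (rule bexI[of _ "h \<cdot> j"]) (simp_all add: homI h whisker[OF h(3)] v'(2))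
  qed
qed

lemma core_equiv_cmp:
  assumes f: "core_equiv f" "f \<in> hom C X Y" and g: "core_equiv g" "g \<in> hom C Y Z"
  shows "core_equiv (g \<cdot> f)"
proof (rule core_equivI[OF cmp_hom[OF f(2) g(2)] core_equiv_fibrant(1)[OF f]
      core_equiv_fibrant(2)[OF g]])
  fix a A B u v
  assume a: "test_cof a" "a \<in> hom C A B" and u: "u \<in> hom C A X" and v: "v \<in> hom C B Z"
    and eq: "g \<cdot> f \<cdot> u = v \<cdot> a"
  note [simp] = homD[OF f(2)] homD[OF g(2)] homD[OF a(2)] homD[OF u] homD[OF v]
  have "g \<cdot> (f \<cdot> u) = v \<cdot> a" using eq by simp
  then obtain k where k: "k \<in> hom C B Y" "k \<cdot> a = f \<cdot> u" "homotopic a (g \<cdot> k) v"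
    using core_equivE[OF g a cmp_hom[OF u f(2)] v] by metis
  obtain h where h: "h \<in> hom C B X" "h \<cdot> a = u" "homotopic a (f \<cdot> h) k"
    using core_equivE[OF f a u k(1) k(2)[symmetric]] .
  note [simp] = homD[OF h(1)]
  have "homotopic a (g \<cdot> (f \<cdot> h)) (g \<cdot> k)"
    by (rule homotopic_whisker[OF h(3) a(2) cmp_hom[OF h(1) f(2)] g(2)])
  then have "homotopic a (g \<cdot> (f \<cdot> h)) v"
    by (rule homotopic_trans[OF _ k(3) a _ core_equiv_fibrant(2)[OF g]]) (simp add: homI)
  then show "\<exists>h\<in>hom C B X. h \<cdot> a = u \<and> homotopic a (g \<cdot> f \<cdot> h) v"
    using h(1,2) by (intro bexI[of _ h]) simp_all
qed

text \<open>Equivalences reflect homotopy: the inclusion of the two ends of a cylinder is itself a test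
  cofibration, so a homotopy in the target of an equivalence lifts to the source.\<close>

lemma core_equiv_reflects_homotopic:
  assumes g: "core_equiv g" "g \<in> hom C Y Z" and a: "test_cof a" "a \<in> hom C A B"
    and x: "x \<in> hom C B Y" and y: "y \<in> hom C B Y" and eq: "x \<cdot> a = y \<cdot> a"
    and hom: "homotopic a (g \<cdot> x) (g \<cdot> y)"
  shows "homotopic a x y"
proof -
  obtain Q i0 i1 I j \<sigma> k where cyl: "relative_cylinder a Q i0 i1 I j \<sigma>" and k: "k \<in> hom C I Z"
    "k \<cdot> (j \<cdot> i0) = g \<cdot> x" "k \<cdot> (j \<cdot> i1) = g \<cdot> y"
    using homotopicE[OF hom a(2) cmp_hom[OF x g(2)]] .
  note c = relative_cylinderD[OF cyl a(2)]
  obtain w where w: "w \<in> hom C Q Y" "w \<cdot> i0 = x" "w \<cdot> i1 = y"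
    using pushout_univ[OF c(1) a(2) a(2) x y eq] .
  note [simp] = homD[OF g(2)] homD[OF a(2)] homD[OF c(2)] homD[OF c(3)] homD[OF c(5)] homD[OF k(1)]
    homD[OF w(1)]
  have "g \<cdot> w = k \<cdot> j"
    by (rule pushout_eq[OF c(1) a(2) a(2), of _ Z]) (simp_all add: homI w(2,3) k(2,3))
  then obtain h where h: "h \<in> hom C I Y" "h \<cdot> j = w"
    using core_equivE[OF g c(6,5) w(1) k(1)] by metis
  note [simp] = homD[OF h(1)]
  show ?thesis using homotopicI[OF cyl a(2) h(1)] by (simp add: whisker[OF h(2)] w(2,3))
qed

lemma core_equiv_cancel_left:
  assumes f: "f \<in> hom C X Y" "fibrant C X" and g: "core_equiv g" "g \<in> hom C Y Z"
    and gf: "core_equiv (g \<cdot> f)"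
  shows "core_equiv f"
proof (rule core_equivI[OF f core_equiv_fibrant(1)[OF g]])
  fix a A B u v
  assume a: "test_cof a" "a \<in> hom C A B" and u: "u \<in> hom C A X" and v: "v \<in> hom C B Y"
    and eq: "f \<cdot> u = v \<cdot> a"
  note [simp] = homD[OF f(1)] homD[OF g(2)] homD[OF a(2)] homD[OF u] homD[OF v]
  have "g \<cdot> f \<cdot> u = (g \<cdot> v) \<cdot> a" by (simp add: eq)
  then obtain h where h: "h \<in> hom C B X" "h \<cdot> a = u" "homotopic a (g \<cdot> f \<cdot> h) (g \<cdot> v)"
    using core_equivE[OF gf cmp_hom[OF f(1) g(2)] a u cmp_hom[OF v g(2)]] by metis
  note [simp] = homD[OF h(1)]
  have "homotopic a (f \<cdot> h) v"
    by (rule core_equiv_reflects_homotopic[OF g a cmp_hom[OF h(1) f(1)] v])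
      (use h(3) in \<open>simp_all add: h(2) eq\<close>)
  then show "\<exists>h\<in>hom C B X. h \<cdot> a = u \<and> homotopic a (f \<cdot> h) v" using h by blast
qed

lemma core_equiv_cancel_anfib:
  assumes p: "p \<in> anfib C" "p \<in> hom C X Y" and g: "g \<in> hom C Y Z"
    and gp: "core_equiv (g \<cdot> p)" and Y: "fibrant C Y"
  shows "core_equiv g"
proof (rule core_equivI[OF g Y core_equiv_fibrant(2)[OF gp cmp_hom[OF p(2) g]]])
  fix a A B u v
  assume a: "test_cof a" "a \<in> hom C A B" and u: "u \<in> hom C A Y" and v: "v \<in> hom C B Z"
    and eq: "g \<cdot> u = v \<cdot> a"
  obtain u' where u': "u' \<in> hom C A X" "p \<cdot> u' = u"
    using cofibrant_lift[OF test_cofD(2)[OF a] p u] .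
  note [simp] = homD[OF p(2)] homD[OF g] homD[OF a(2)] homD[OF u'(1)]
  have "g \<cdot> p \<cdot> u' = v \<cdot> a" by (simp add: u'(2) eq)
  then obtain h where h: "h \<in> hom C B X" "h \<cdot> a = u'" "homotopic a (g \<cdot> p \<cdot> h) v"
    using core_equivE[OF gp cmp_hom[OF p(2) g] a u'(1) v] by metis
  note [simp] = homD[OF h(1)]
  show "\<exists>h\<in>hom C B Y. h \<cdot> a = u \<and> homotopic a (g \<cdot> h) v"
    by (rule bexI[of _ "p \<cdot> h"]) (use h(3) in \<open>simp_all add: homI h(2) u'(2)\<close>)
qed

text \<open>Applied to the square with two identities, the definition of a core equivalence makes \<open>c\<close> a strong
  deformation retract with retraction \<open>r\<close>. A lifting problem \<open>(u, v)\<close> against a core fibration is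
  solved by deforming \<open>u \<cdot> r\<close>: it covers \<open>v\<close> restricted to one end of the contraction, and the
  homotopy lifting property carries it to the other end.\<close>

lemma core_equiv_test_cof_acyclic:
  assumes c: "core_equiv c" "c \<in> hom C X Y" "test_cof c"
  shows "c \<in> acyclic_cof C"
proof (rule acyclic_cofI[OF test_cofD(1)[OF c(3,2)]])
  note [simp] = homD[OF c(2)]
  have "c \<cdot> idn C X = idn C Y \<cdot> c" by simp
  then obtain r where r: "r \<in> hom C Y X" "r \<cdot> c = idn C X" "homotopic c (c \<cdot> r) (idn C Y)"
    using core_equivE[OF c(1,2,3,2) idn_hom[OF homD(4)[OF c(2)]] idn_hom[OF homD(5)[OF c(2)]]]
    by metis
  obtain Q i0 i1 I j \<sigma> k where cyl: "relative_cylinder c Q i0 i1 I j \<sigma>" and k: "k \<in> hom C I Y"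
    "k \<cdot> (j \<cdot> i0) = c \<cdot> r" "k \<cdot> (j \<cdot> i1) = idn C Y"
    using homotopicE[OF r(3) c(2) cmp_hom[OF r(1) c(2)]] .
  note y = relative_cylinderD[OF cyl c(2)]
  fix p E F
  assume p: "p \<in> fib C" "p \<in> hom C E F" "fibrant C F"
  show "has_lift C c p"
  proof (rule has_liftI[OF c(2) p(2)])
    fix u v
    assume u: "u \<in> hom C X E" and v: "v \<in> hom C Y F" and eq: "p \<cdot> u = v \<cdot> c"
    note [simp] = homD[OF r(1)] homD[OF k(1)] homD[OF y(2)] homD[OF y(3)] homD[OF y(5)]
      homD[OF p(2)] homD[OF u] homD[OF v]
    have "p \<cdot> (u \<cdot> r) = (v \<cdot> k) \<cdot> (j \<cdot> i0)" by (simp add: whisker[OF eq] k(2))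
    then obtain l where l: "l \<in> hom C I E" "l \<cdot> (j \<cdot> i0) = u \<cdot> r" "p \<cdot> l = v \<cdot> k"
      using has_liftE[OF acyclic_cof_lift[OF y(7) p] y(8) p(2) cmp_hom[OF r(1) u] cmp_hom[OF k(1) v]]
      by metis
    note [simp] = homD[OF l(1)]
    have "l \<cdot> (j \<cdot> i1) \<cdot> c = l \<cdot> (j \<cdot> i0) \<cdot> c" by (simp add: y(4))
    also have "\<dots> = u" by (simp only: l(2)) (simp add: r(2))
    finally have "l \<cdot> (j \<cdot> i1) \<cdot> c = u" .
    moreover have "p \<cdot> (l \<cdot> (j \<cdot> i1)) = v" by (simp add: whisker[OF l(3)] k(3))
    moreover have "l \<cdot> (j \<cdot> i1) \<in> hom C Y E" by (simp add: homI)
    ultimately show "\<exists>h\<in>hom C Y E. h \<cdot> c = u \<and> p \<cdot> h = v" by blast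
  qed
qed

text \<open>Write \<open>q \<cdot> d = \<phi> \<cdot> c\<close> with \<open>\<phi>\<close> anodyne; then \<open>c\<close> is an acyclic cofibration. Lifting gives
  maps \<open>m\<close>, \<open>n\<close> over \<open>Z\<close> between \<open>W\<close> and \<open>Y\<close>, and \<open>m \<cdot> n\<close> is homotopic to the identity over
  \<open>Z\<close>. So a lifting problem against \<open>q\<close> can be moved to \<open>\<phi>\<close> along \<open>n\<close>, solved there and moved back
  along \<open>m\<close>; the homotopy over \<open>Z\<close> repairs the upper triangle without disturbing the lower one.\<close>

lemma fib_after_acyclic_cof_anfib:
  assumes d: "d \<in> acyclic_cof C" "d \<in> hom C X Y" and q: "q \<in> fib C" "q \<in> hom C Y Z"
    and X: "cofibrant C X" and qd: "core_equiv (q \<cdot> d)"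
  shows "q \<in> anfib C"
proof -
  have qd_hom: "q \<cdot> d \<in> hom C X Z" using cmp_hom[OF d(2) q(2)] .
  note Xf = core_equiv_fibrant(1)[OF qd qd_hom] and Zf = core_equiv_fibrant(2)[OF qd qd_hom]
  note Yc = cofibrant_tgt[OF acyclic_cof_cof[OF d(1)] d(2) X]
  obtain c \<phi> W where c: "c \<in> cof C" "c \<in> hom C X W" and \<phi>: "\<phi> \<in> anfib C" "\<phi> \<in> hom C W Z"
    and \<phi>c: "\<phi> \<cdot> c = q \<cdot> d"
    using wfs_factor[OF cof_anfib qd_hom] by metis
  have Wf: "fibrant C W" using fibrant_src[OF anfib_fib[OF \<phi>(1)] \<phi>(2) Zf] .
  have "core_equiv c"
    using core_equiv_cancel_left[OF c(2) Xf core_equiv_anfib[OF \<phi> Zf] \<phi>(2)] qd by (simp add: \<phi>c)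
  then have c_acyc: "c \<in> acyclic_cof C"
    using core_equiv_test_cof_acyclic[OF _ c(2) test_cofI[OF c X Wf]] by blast
  obtain m where m: "m \<in> hom C W Y" "m \<cdot> c = d" "q \<cdot> m = \<phi>"
    using has_liftE[OF acyclic_cof_lift[OF c_acyc q Zf] c(2) q(2) d(2) \<phi>(2) \<phi>c[symmetric]] .
  obtain n where n: "n \<in> hom C Y W" "n \<cdot> d = c" "\<phi> \<cdot> n = q"
    using has_liftE[OF acyclic_cof_lift[OF d(1) anfib_fib[OF \<phi>(1)] \<phi>(2) Zf] d(2) \<phi>(2) c(2) q(2) \<phi>c] .
  note [simp] = homD[OF d(2)] homD[OF q(2)] homD[OF c(2)] homD[OF \<phi>(2)] homD[OF m(1)] homD[OF n(1)]
  have "has_relative_strong_path C q" using relative_path[OF q(1)] Yc Zf by simp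
  then obtain P s d0 d1 where P: "s \<in> hom C Y P" "d0 \<in> hom C P Y" "d1 \<in> hom C P Y"
      "d0 \<cdot> s = idn C Y" "d1 \<cdot> s = idn C Y" "d0 \<in> acyclic_fib C" "q \<cdot> d0 = q \<cdot> d1"
    and lift: "\<And>A B i w x y. \<lbrakk>i \<in> acyclic_cof C; i \<in> hom C A B; w \<in> hom C A P; x \<in> hom C B Y;
      y \<in> hom C B Y; q \<cdot> x = q \<cdot> y; d0 \<cdot> w = x \<cdot> i; d1 \<cdot> w = y \<cdot> i\<rbrakk>
      \<Longrightarrow> \<exists>h\<in>hom C B P. h \<cdot> i = w \<and> d0 \<cdot> h = x \<and> d1 \<cdot> h = y"
    using relative_strong_pathE[OF _ q(2,1) Zf] by metis
  note [simp] = homD[OF P(1)] homD[OF P(2)] homD[OF P(3)]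
  \<comment> \<open>the contraction of \<open>m \<cdot> n\<close> over \<open>Z\<close>, constant on \<open>X\<close>\<close>
  have "\<exists>h\<in>hom C Y P. h \<cdot> d = s \<cdot> d \<and> d0 \<cdot> h = m \<cdot> n \<and> d1 \<cdot> h = idn C Y"
    by (rule lift[OF d])
      (simp_all add: homI whisker[OF m(3)] n(2,3) m(2) whisker[OF P(4)] whisker[OF P(5)])
  then obtain t where t: "t \<in> hom C Y P" "d0 \<cdot> t = m \<cdot> n" "d1 \<cdot> t = idn C Y" by blast
  note [simp] = homD[OF t(1)]
  show ?thesis
  proof (rule saturated[OF acyclic_fibI[OF q(1)] q(2) Zf])
    fix i A B
    assume i: "i \<in> cof C" "i \<in> hom C A B" and A: "cofibrant C A"
    show "has_lift C i q"
    proof (rule has_liftI[OF i(2) q(2)])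
      fix u v
      assume u: "u \<in> hom C A Y" and v: "v \<in> hom C B Z" and eq: "q \<cdot> u = v \<cdot> i"
      note [simp] = homD[OF i(2)] homD[OF u] homD[OF v]
      have "\<phi> \<cdot> (n \<cdot> u) = v \<cdot> i" by (simp add: whisker[OF n(3)] eq)
      then obtain k where k: "k \<in> hom C B W" "k \<cdot> i = n \<cdot> u" "\<phi> \<cdot> k = v"
        using has_liftE[OF cof_lift[OF i(1) \<phi>(1)] i(2) \<phi>(2) cmp_hom[OF u n(1)] v] by metis
      note [simp] = homD[OF k(1)]
      \<comment> \<open>\<open>m \<cdot> k\<close> is correct over \<open>Z\<close> but restricts to \<open>m \<cdot> n \<cdot> u\<close> instead of \<open>u\<close>; transport it along
        the homotopy \<open>t \<cdot> u\<close>\<close>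
      have "d0 \<cdot> (t \<cdot> u) = (m \<cdot> k) \<cdot> i" by (simp add: whisker[OF t(2)] k(2))
      then obtain w where w: "w \<in> hom C B P" "w \<cdot> i = t \<cdot> u" "d0 \<cdot> w = m \<cdot> k"
        using has_liftE[OF acyclic_fib_lift[OF P(6) i A] i(2) P(2) cmp_hom[OF u t(1)]
            cmp_hom[OF k(1) m(1)]] by metis
      note [simp] = homD[OF w(1)]
      have "(d1 \<cdot> w) \<cdot> i = u" by (simp add: w(2) whisker[OF t(3)])
      moreover have "q \<cdot> (d1 \<cdot> w) = v"
        using whisker[OF P(7), of w] by (simp add: w(3) whisker[OF m(3)] k(3))
      moreover have "d1 \<cdot> w \<in> hom C B Y" by (simp add: homI)
      ultimately show "\<exists>h\<in>hom C B Y. h \<cdot> i = u \<and> q \<cdot> h = v" by blast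
    qed
  qed
qed

text \<open>Relative path objects are available only for fibrations with cofibrant source. So \<open>f\<close> is first
  replaced by a map \<open>c\<close> between cofibrant objects, over anodyne fibrations \<open>\<pi>\<close> and \<open>\<phi>\<close>. Being a test
  cofibration and a core equivalence, \<open>c\<close> is acyclic, and \<open>g \<cdot> \<phi>\<close> is compared with the fibration
  \<open>q\<close> in its factorization.\<close>

lemma core_equiv_cancel_right:
  assumes f: "core_equiv f" "f \<in> hom C X Y" and g: "g \<in> hom C Y Z"
    and gf: "core_equiv (g \<cdot> f)"
  shows "core_equiv g"
proof -
  note Xf = core_equiv_fibrant(1)[OF f] and Yf = core_equiv_fibrant(2)[OF f]
  note Zf = core_equiv_fibrant(2)[OF gf cmp_hom[OF f(2) g]]
  obtain X' \<pi> where \<pi>: "\<pi> \<in> anfib C" "\<pi> \<in> hom C X' X" and X': "cofibrant C X'"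
    using cofibrant_replacement[OF fibrant_obj[OF Xf]] by metis
  have X'f: "fibrant C X'" using fibrant_src[OF anfib_fib[OF \<pi>(1)] \<pi>(2) Xf] .
  note \<pi>_eq = core_equiv_anfib[OF \<pi> Xf]
  obtain c \<phi> Y' where c: "c \<in> cof C" "c \<in> hom C X' Y'" and \<phi>: "\<phi> \<in> anfib C" "\<phi> \<in> hom C Y' Y"
    and \<phi>c: "\<phi> \<cdot> c = f \<cdot> \<pi>"
    using wfs_factor[OF cof_anfib cmp_hom[OF \<pi>(2) f(2)]] by metis
  have Y'f: "fibrant C Y'" using fibrant_src[OF anfib_fib[OF \<phi>(1)] \<phi>(2) Yf] .
  have "core_equiv c"
    using core_equiv_cancel_left[OF c(2) X'f core_equiv_anfib[OF \<phi> Yf] \<phi>(2)]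
      core_equiv_cmp[OF \<pi>_eq \<pi>(2) f] by (simp add: \<phi>c)
  then have c_acyc: "c \<in> acyclic_cof C"
    using core_equiv_test_cof_acyclic[OF _ c(2) test_cofI[OF c X' Y'f]] by blast
  obtain j q M where j: "j \<in> ancof C" "j \<in> hom C Y' M" and q: "q \<in> fib C" "q \<in> hom C M Z"
    and qj: "q \<cdot> j = g \<cdot> \<phi>"
    using wfs_factor[OF ancof_fib cmp_hom[OF \<phi>(2) g]] by metis
  note Mf = fibrant_src[OF q Zf]
  note [simp] = homD[OF f(2)] homD[OF g] homD[OF \<pi>(2)] homD[OF c(2)] homD[OF \<phi>(2)] homD[OF j(2)]
    homD[OF q(2)]
  have "q \<cdot> (j \<cdot> c) = g \<cdot> f \<cdot> \<pi>" by (simp add: whisker[OF qj] \<phi>c)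
  then have "core_equiv (q \<cdot> (j \<cdot> c))"
    using core_equiv_cmp[OF \<pi>_eq \<pi>(2) gf cmp_hom[OF f(2) g]] by simp
  then have "q \<in> anfib C"
    using fib_after_acyclic_cof_anfib[OF acyclic_cof_cmp[OF c_acyc ancof_acyclic_cof[OF j(1)] c(2) j(2)]
        cmp_hom[OF c(2) j(2)] q X'] by blast
  then have "core_equiv (g \<cdot> \<phi>)"
    using core_equiv_cmp[OF core_equiv_ancof[OF j Y'f Mf] j(2) core_equiv_anfib[OF _ q(2) Zf] q(2)]
    by (simp add: qj)
  then show ?thesis using core_equiv_cancel_anfib[OF \<phi> g _ Yf] by blast
qed

end

section \<open>Equivalences between arbitrary objects\<close>

context premodel_cat
begin

text \<open>The square \<open>f' \<cdot> x = y \<cdot> f\<close> exhibits \<open>f'\<close> as a fibrant replacement of the arrow \<open>f\<close>.\<close>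

definition fibrant_approx :: "'m \<Rightarrow> 'm \<Rightarrow> 'm \<Rightarrow> 'm \<Rightarrow> bool" where
  "fibrant_approx f x y f' \<longleftrightarrow> x \<in> ancof C \<and> y \<in> ancof C \<and> src C x = src C f \<and> src C y = tgt C f \<and>
     fibrant C (tgt C x) \<and> fibrant C (tgt C y) \<and> f' \<in> hom C (tgt C x) (tgt C y) \<and> f' \<cdot> x = y \<cdot> f"

definition equivs :: "'m set" where
  "equivs = {f \<in> arr C. \<exists>x y f'. fibrant_approx f x y f' \<and> core_equiv f'}"

lemma fibrant_approxI:
  assumes "f \<in> hom C X Y" "x \<in> ancof C" "x \<in> hom C X X'" "fibrant C X'"
    "y \<in> ancof C" "y \<in> hom C Y Y'" "fibrant C Y'" "f' \<in> hom C X' Y'" "f' \<cdot> x = y \<cdot> f"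
  shows "fibrant_approx f x y f'"
  using assms homD[OF assms(1)] homD[OF assms(3)] homD[OF assms(6)] by (simp add: fibrant_approx_def)

lemma fibrant_approxE:
  assumes "fibrant_approx f x y f'" "f \<in> hom C X Y"
  obtains X' Y' where "x \<in> ancof C" "x \<in> hom C X X'" "fibrant C X'"
    "y \<in> ancof C" "y \<in> hom C Y Y'" "fibrant C Y'" "f' \<in> hom C X' Y'" "f' \<cdot> x = y \<cdot> f"
  using assms(1) that[of "tgt C x" "tgt C y"] homD(2,3)[OF assms(2)] ancof_arr
  unfolding fibrant_approx_def by (auto intro: homI)

lemma approx_extension:
  assumes "f \<in> hom C X Y" "x \<in> ancof C" "x \<in> hom C X X'" "fibrant C X'"
    "y \<in> ancof C" "y \<in> hom C Y Y'" "fibrant C Y'"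
  obtains f' where "f' \<in> hom C X' Y'" "f' \<cdot> x = y \<cdot> f" "fibrant_approx f x y f'"
  using fibrant_extension[OF assms(7) ancof_acyclic_cof[OF assms(2)] assms(3) cmp_hom[OF assms(1,6)]]
    fibrant_approxI[OF assms] that by metis

lemma ex_fibrant_approx:
  assumes "f \<in> hom C X Y"
  obtains x y f' where "fibrant_approx f x y f'"
proof -
  obtain X' x where x: "x \<in> ancof C" "x \<in> hom C X X'" "fibrant C X'"
    using fibrant_replacement[OF homD(4)[OF assms]] by metis
  obtain Y' y where y: "y \<in> ancof C" "y \<in> hom C Y Y'" "fibrant C Y'"
    using fibrant_replacement[OF homD(5)[OF assms]] by metis
  show ?thesis using approx_extension[OF assms x y] that by metis
qed

text \<open>Push \<open>x\<close> out along \<open>s\<close> and replace the result by a fibrant object. The last property is the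
  universal property of the pushout, weakened to existence by that replacement.\<close>

lemma replacement_along:
  assumes x: "x \<in> ancof C" "x \<in> hom C X X'" and s: "s \<in> hom C X U"
  obtains U' u t where "u \<in> ancof C" "u \<in> hom C U U'" "fibrant C U'" "t \<in> hom C X' U'" "t \<cdot> x = u \<cdot> s"
    "s \<in> ancof C \<Longrightarrow> t \<in> ancof C" "s \<in> cof C \<Longrightarrow> t \<in> cof C"
    "\<And>V \<alpha> \<beta>. \<lbrakk>fibrant C V; \<alpha> \<in> hom C X' V; \<beta> \<in> hom C U V; \<alpha> \<cdot> x = \<beta> \<cdot> s\<rbrakk>
      \<Longrightarrow> \<exists>\<gamma>\<in>hom C U' V. \<gamma> \<cdot> t = \<alpha> \<and> \<gamma> \<cdot> u = \<beta>"
proof -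
  obtain P a b where P: "is_pushout C x s P a b" using pushouts[OF x(2) s] by blast
  note po = pushoutD[OF P x(2) s]
  have b: "b \<in> ancof C" using wfs_left_pushout[OF ancof_fib x(1) P] .
  obtain k U' where k: "k \<in> ancof C" "k \<in> hom C P U'" "fibrant C U'"
    using fibrant_replacement[OF homD(5)[OF po(1)]] by metis
  note [simp] = homD[OF x(2)] homD[OF s] homD[OF po(1)] homD[OF po(2)] homD[OF k(2)]
  show ?thesis
  proof (rule that[of "k \<cdot> b" U' "k \<cdot> a"])
    show "k \<cdot> b \<in> ancof C" using ancof_cmp[OF b k(1) po(2) k(2)] .
    show "k \<cdot> a \<in> ancof C" if "s \<in> ancof C"
      using ancof_cmp[OF wfs_left_pushout[OF ancof_fib that is_pushout_commute[OF P]] k(1) po(1) k(2)] .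
    show "k \<cdot> a \<in> cof C" if "s \<in> cof C"
      using cof_cmp[OF wfs_left_pushout[OF cof_anfib that is_pushout_commute[OF P]] ancof_cof[OF k(1)]
          po(1) k(2)] .
    fix V \<alpha> \<beta>
    assume V: "fibrant C V" and \<alpha>: "\<alpha> \<in> hom C X' V" and \<beta>: "\<beta> \<in> hom C U V" and eq: "\<alpha> \<cdot> x = \<beta> \<cdot> s"
    obtain w where w: "w \<in> hom C P V" "w \<cdot> a = \<alpha>" "w \<cdot> b = \<beta>"
      using pushout_univ[OF P x(2) s \<alpha> \<beta> eq] .
    obtain \<gamma> where \<gamma>: "\<gamma> \<in> hom C U' V" "\<gamma> \<cdot> k = w"
      using fibrant_extension[OF V ancof_acyclic_cof[OF k(1)] k(2) w(1)] .
    note [simp] = homD[OF w(1)] homD[OF \<gamma>(1)]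
    show "\<exists>\<gamma>\<in>hom C U' V. \<gamma> \<cdot> (k \<cdot> a) = \<alpha> \<and> \<gamma> \<cdot> (k \<cdot> b) = \<beta>"
      by (rule bexI[OF _ \<gamma>(1)]) (simp add: whisker[OF \<gamma>(2)] w)
  qed (simp_all add: homI po(3) k(3))
qed

text \<open>Without a functorial fibrant replacement, replacements of two arrows chosen in advance are
  related at best up to homotopy. Choosing the replacement of the target arrow after that of the
  source arrow gives a strictly commutative cube.\<close>

lemma fibrant_approx_push:
  assumes f: "f \<in> hom C X Y" and g: "g \<in> hom C U V" and s: "s \<in> hom C X U" "s' \<in> hom C Y V"
    and sq: "g \<cdot> s = s' \<cdot> f" and app: "fibrant_approx f x y f'"
  obtains u v g' t t' where "fibrant_approx g u v g'" "t \<in> hom C (tgt C x) (tgt C u)"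
    "t' \<in> hom C (tgt C y) (tgt C v)" "t \<cdot> x = u \<cdot> s" "t' \<cdot> y = v \<cdot> s'" "g' \<cdot> t = t' \<cdot> f'"
    "s \<in> ancof C \<Longrightarrow> t \<in> ancof C" "s' \<in> ancof C \<Longrightarrow> t' \<in> ancof C"
proof -
  obtain X' Y' where x: "x \<in> ancof C" "x \<in> hom C X X'" "fibrant C X'"
    and y: "y \<in> ancof C" "y \<in> hom C Y Y'" "fibrant C Y'" and f': "f' \<in> hom C X' Y'" "f' \<cdot> x = y \<cdot> f"
    using fibrant_approxE[OF app f] .
  obtain U' u t where u: "u \<in> ancof C" "u \<in> hom C U U'" "fibrant C U'"
    and t: "t \<in> hom C X' U'" "t \<cdot> x = u \<cdot> s" "s \<in> ancof C \<Longrightarrow> t \<in> ancof C"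
    and ext: "\<And>V \<alpha> \<beta>. \<lbrakk>fibrant C V; \<alpha> \<in> hom C X' V; \<beta> \<in> hom C U V; \<alpha> \<cdot> x = \<beta> \<cdot> s\<rbrakk>
      \<Longrightarrow> \<exists>\<gamma>\<in>hom C U' V. \<gamma> \<cdot> t = \<alpha> \<and> \<gamma> \<cdot> u = \<beta>"
    using replacement_along[OF x(1,2) s(1)] by metis
  obtain V' v t' where v: "v \<in> ancof C" "v \<in> hom C V V'" "fibrant C V'"
    and t': "t' \<in> hom C Y' V'" "t' \<cdot> y = v \<cdot> s'" "s' \<in> ancof C \<Longrightarrow> t' \<in> ancof C"
    using replacement_along[OF y(1,2) s(2)] by metis
  note [simp] = homD[OF f] homD[OF g] homD[OF s(1)] homD[OF s(2)] homD[OF x(2)] homD[OF y(2)]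
    homD[OF f'(1)] homD[OF u(2)] homD[OF v(2)] homD[OF t(1)] homD[OF t'(1)]
  have "(t' \<cdot> f') \<cdot> x = (v \<cdot> g) \<cdot> s" by (simp add: f'(2) whisker[OF t'(2)] sq)
  with ext[OF v(3) cmp_hom[OF f'(1) t'(1)] cmp_hom[OF g v(2)]]
  obtain g' where g': "g' \<in> hom C U' V'" "g' \<cdot> t = t' \<cdot> f'" "g' \<cdot> u = v \<cdot> g" by blast
  show ?thesis
    by (rule that[OF fibrant_approxI[OF g u v g'(1,3)], of t t']) (use t t' g' in simp_all)
qed

end

context core_saturated_premodel
begin

lemma core_equiv_square_iff:
  assumes t: "core_equiv t" "t \<in> hom C X U" and t': "core_equiv t'" "t' \<in> hom C Y V"
    and f: "f \<in> hom C X Y" and g: "g \<in> hom C U V" and sq: "g \<cdot> t = t' \<cdot> f"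
  shows "core_equiv f \<longleftrightarrow> core_equiv g"
proof
  assume "core_equiv f"
  from core_equiv_cmp[OF this f t'] show "core_equiv g"
    using core_equiv_cancel_right[OF t g] by (simp add: sq)
next
  assume "core_equiv g"
  from core_equiv_cmp[OF t this g] show "core_equiv f"
    using core_equiv_cancel_left[OF f core_equiv_fibrant(1)[OF t] t'] by (simp add: sq)
qed

text \<open>The map \<open>(x2, y2)\<close> of arrows from \<open>f\<close> to its second replacement has anodyne components. Pushing the
  first replacement forward along it gives a third one, to which both are connected by anodyne
  cofibrations between fibrant objects.\<close>

lemma fibrant_approx_unique:
  assumes f: "f \<in> hom C X Y" and 1: "fibrant_approx f x y f'" and 2: "fibrant_approx f x2 y2 f2"
  shows "core_equiv f' \<longleftrightarrow> core_equiv f2"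
proof -
  obtain X' Y' where x: "x \<in> ancof C" "x \<in> hom C X X'" "fibrant C X'"
    and y: "y \<in> ancof C" "y \<in> hom C Y Y'" "fibrant C Y'" and f': "f' \<in> hom C X' Y'" "f' \<cdot> x = y \<cdot> f"
    using fibrant_approxE[OF 1 f] .
  obtain X2 Y2 where x2: "x2 \<in> ancof C" "x2 \<in> hom C X X2" "fibrant C X2"
    and y2: "y2 \<in> ancof C" "y2 \<in> hom C Y Y2" "fibrant C Y2"
    and f2: "f2 \<in> hom C X2 Y2" "f2 \<cdot> x2 = y2 \<cdot> f"
    using fibrant_approxE[OF 2 f] .
  obtain u v g t t' where app: "fibrant_approx f2 u v g"
    and t: "t \<in> hom C X' (tgt C u)" "t' \<in> hom C Y' (tgt C v)" "g \<cdot> t = t' \<cdot> f'" "t \<in> ancof C" "t' \<in> ancof C"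
    using fibrant_approx_push[OF f f2(1) x2(2) y2(2) f2(2) 1] x2(1) y2(1) homD(3)[OF x(2)]
      homD(3)[OF y(2)] by metis
  obtain U' V' where u: "u \<in> ancof C" "u \<in> hom C X2 U'" "fibrant C U'"
    and v: "v \<in> ancof C" "v \<in> hom C Y2 V'" "fibrant C V'" and g: "g \<in> hom C U' V'" "g \<cdot> u = v \<cdot> f2"
    using fibrant_approxE[OF app f2(1)] .
  have t1: "t \<in> hom C X' U'" "t' \<in> hom C Y' V'" using t homD(3)[OF u(2)] homD(3)[OF v(2)] by simp_all
  have "core_equiv f' \<longleftrightarrow> core_equiv g"
    using core_equiv_square_iff[OF core_equiv_ancof[OF t(4) t1(1) x(3) u(3)] t1(1)
        core_equiv_ancof[OF t(5) t1(2) y(3) v(3)] t1(2) f'(1) g(1) t(3)] .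
  also have "\<dots> \<longleftrightarrow> core_equiv f2"
    using core_equiv_square_iff[OF core_equiv_ancof[OF u(1,2) x2(3) u(3)] u(2)
        core_equiv_ancof[OF v(1,2) y2(3) v(3)] v(2) f2(1) g] by simp
  finally show ?thesis .
qed

lemma equivs_iff:
  assumes "f \<in> hom C X Y" "fibrant_approx f x y f'"
  shows "f \<in> equivs \<longleftrightarrow> core_equiv f'"
  using fibrant_approx_unique[OF assms(1)] assms homD(1) unfolding equivs_def by blast

lemma equivs_core:
  assumes "f \<in> hom C X Y" "fibrant C X" "fibrant C Y"
  shows "f \<in> equivs \<longleftrightarrow> core_equiv f"
proof (rule equivs_iff[OF assms(1)])
  note X = fibrant_obj[OF assms(2)] and Y = fibrant_obj[OF assms(3)]
  note [simp] = homD[OF assms(1)]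
  show "fibrant_approx f (idn C X) (idn C Y) f"
    by (rule fibrant_approxI[OF assms(1) wfs_left_idn[OF ancof_fib X] idn_hom[OF X] assms(2)
          wfs_left_idn[OF ancof_fib Y] idn_hom[OF Y] assms(3,1)]) simp
qed

lemma ancof_equivs:
  assumes "i \<in> ancof C"
  shows "i \<in> equivs"
proof -
  have i: "i \<in> hom C (src C i) (tgt C i)" using assms ancof_arr arr_hom by blast
  obtain Y y where y: "y \<in> ancof C" "y \<in> hom C (tgt C i) Y" "fibrant C Y"
    using fibrant_replacement[OF homD(5)[OF i]] by metis
  note yi = cmp_hom[OF i y(2)]
  note [simp] = homD[OF yi]
  have "fibrant_approx i (y \<cdot> i) y (idn C Y)"
    by (rule fibrant_approxI[OF i ancof_cmp[OF assms y(1) i y(2)] yi y(3) y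
          idn_hom[OF fibrant_obj[OF y(3)]]]) simp
  then show ?thesis using equivs_iff[OF i] core_equiv_idn[OF y(3)] by blast
qed

lemma anfib_equivs:
  assumes "p \<in> anfib C" "p \<in> hom C X Y" "fibrant C Y"
  shows "p \<in> equivs"
  using equivs_core[OF assms(2) fibrant_src[OF anfib_fib[OF assms(1)] assms(2,3)] assms(3)]
    core_equiv_anfib[OF assms] by blast

lemma fib_equivs_anfib:
  assumes "p \<in> fib C" "p \<in> equivs" "p \<in> hom C X Y" "fibrant C Y"
  shows "p \<in> anfib C"
  using equivs_core[OF assms(3) fibrant_src[OF assms(1,3,4)] assms(4)]
    core_equiv_fib_anfib[OF _ assms(1,3)] assms(2) by blast

lemma two_out_of_three_equivs: "two_out_of_three C equivs"
  unfolding two_out_of_three_def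
proof (intro ballI impI)
  fix f g
  assume "f \<in> arr C" "g \<in> arr C" "tgt C f = src C g"
  then obtain X Y Z where f: "f \<in> hom C X Y" and g: "g \<in> hom C Y Z" using arr_hom by metis
  obtain x X' where x: "x \<in> ancof C" "x \<in> hom C X X'" "fibrant C X'"
    using fibrant_replacement[OF homD(4)[OF f]] by metis
  obtain y Y' where y: "y \<in> ancof C" "y \<in> hom C Y Y'" "fibrant C Y'"
    using fibrant_replacement[OF homD(4)[OF g]] by metis
  obtain z Z' where z: "z \<in> ancof C" "z \<in> hom C Z Z'" "fibrant C Z'"
    using fibrant_replacement[OF homD(5)[OF g]] by metis
  obtain f' where f': "f' \<in> hom C X' Y'" "f' \<cdot> x = y \<cdot> f" "fibrant_approx f x y f'"
    using approx_extension[OF f x y] .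
  obtain g' where g': "g' \<in> hom C Y' Z'" "g' \<cdot> y = z \<cdot> g" "fibrant_approx g y z g'"
    using approx_extension[OF g y z] .
  note [simp] = homD[OF f] homD[OF g] homD[OF x(2)] homD[OF y(2)] homD[OF z(2)] homD[OF f'(1)]
    homD[OF g'(1)]
  note gf = cmp_hom[OF f g] and gf' = cmp_hom[OF f'(1) g'(1)]
  have "fibrant_approx (g \<cdot> f) x z (g' \<cdot> f')"
    by (rule fibrant_approxI[OF gf x z gf']) (simp add: f'(2) whisker[OF g'(2)])
  note iff = equivs_iff[OF f f'(3)] equivs_iff[OF g g'(3)] equivs_iff[OF gf this]
  show "(f \<in> equivs \<and> g \<in> equivs \<longrightarrow> g \<cdot> f \<in> equivs) \<and>
        (f \<in> equivs \<and> g \<cdot> f \<in> equivs \<longrightarrow> g \<in> equivs) \<and>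
        (g \<in> equivs \<and> g \<cdot> f \<in> equivs \<longrightarrow> f \<in> equivs)"
    unfolding iff
    using core_equiv_cmp[OF _ f'(1) _ g'(1)] core_equiv_cancel_right[OF _ f'(1) g'(1)]
      core_equiv_cancel_left[OF f'(1) x(3) _ g'(1)] by blast
qed

text \<open>Replacing all arrows of a retract diagram turns the composites of sections and retractions, which
  were identities, into core equivalences. The filler \<open>h\<close> obtained from \<open>g\<close> is mapped forward by
  \<open>r\<close> and then pulled back along the equivalence \<open>r \<cdot> t\<close>; the homotopy in the lower triangle is
  reflected by \<open>r' \<cdot> t'\<close>.\<close>

lemma core_equiv_retract_up_to_equiv:
  assumes f: "f \<in> hom C X Y" and g: "core_equiv g" "g \<in> hom C U V" and f2: "f2 \<in> hom C X2 Y2"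
    and t: "t \<in> hom C X U" "t' \<in> hom C Y V" and r: "r \<in> hom C U X2" "r' \<in> hom C V Y2"
    and sq: "g \<cdot> t = t' \<cdot> f" "f2 \<cdot> r = r' \<cdot> g"
    and rt: "core_equiv (r \<cdot> t)" "core_equiv (r' \<cdot> t')"
  shows "core_equiv f"
proof (rule core_equivI[OF f])
  note [simp] = homD[OF f] homD[OF g(2)] homD[OF f2] homD[OF t(1)] homD[OF t(2)] homD[OF r(1)]
    homD[OF r(2)]
  note rt_hom = cmp_hom[OF t(1) r(1)] cmp_hom[OF t(2) r(2)]
  show "fibrant C X" "fibrant C Y" using core_equiv_fibrant(1) rt rt_hom by blast+
  fix a A B u v
  assume a: "test_cof a" "a \<in> hom C A B" and u: "u \<in> hom C A X" and v: "v \<in> hom C B Y"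
    and eq: "f \<cdot> u = v \<cdot> a"
  note [simp] = homD[OF a(2)] homD[OF u] homD[OF v]
  have "g \<cdot> (t \<cdot> u) = (t' \<cdot> v) \<cdot> a" by (simp add: whisker[OF sq(1)] eq)
  then obtain h where h: "h \<in> hom C B U" "h \<cdot> a = t \<cdot> u" "homotopic a (g \<cdot> h) (t' \<cdot> v)"
    using core_equivE[OF g a cmp_hom[OF u t(1)] cmp_hom[OF v t(2)]] by metis
  note [simp] = homD[OF h(1)]
  have "r \<cdot> t \<cdot> u = (r \<cdot> h) \<cdot> a" by (simp add: h(2))
  then obtain k where k: "k \<in> hom C B X" "k \<cdot> a = u" "homotopic a (r \<cdot> t \<cdot> k) (r \<cdot> h)"
    using core_equivE[OF rt(1) rt_hom(1) a u cmp_hom[OF h(1) r(1)]] by metis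
  note [simp] = homD[OF k(1)]
  have "homotopic a (f2 \<cdot> (r \<cdot> t \<cdot> k)) (f2 \<cdot> (r \<cdot> h))"
    by (rule homotopic_whisker[OF k(3) a(2) _ f2]) (simp add: homI)
  then have 1: "homotopic a (r' \<cdot> t' \<cdot> (f \<cdot> k)) (r' \<cdot> (g \<cdot> h))"
    by (simp add: whisker[OF sq(2)] whisker[OF sq(1)])
  have 2: "homotopic a (r' \<cdot> (g \<cdot> h)) (r' \<cdot> (t' \<cdot> v))"
    by (rule homotopic_whisker[OF h(3) a(2) cmp_hom[OF h(1) g(2)] r(2)])
  have "homotopic a (r' \<cdot> t' \<cdot> (f \<cdot> k)) (r' \<cdot> t' \<cdot> v)"
    using homotopic_trans[OF 1 2 a _ core_equiv_fibrant(2)[OF rt(2) rt_hom(2)]] by (simp add: homI)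
  then have "homotopic a (f \<cdot> k) v"
    by (rule core_equiv_reflects_homotopic[OF rt(2) rt_hom(2) a cmp_hom[OF k(1) f] v, rotated])
      (simp add: k(2) eq)
  then show "\<exists>h\<in>hom C B X. h \<cdot> a = u \<and> homotopic a (f \<cdot> h) v" using k by blast
qed

lemma retract_stable_equivs: "retract_stable C equivs"
  unfolding retract_stable_def
proof (intro ballI impI)
  fix f g
  assume fg: "f \<in> arr C" "g \<in> equivs" "is_retract C f g"
  then obtain X Y U V where f: "f \<in> hom C X Y" and g: "g \<in> hom C U V"
    using arr_hom unfolding equivs_def by blast
  obtain s r s' r' where s: "s \<in> hom C X U" "s' \<in> hom C Y V"
    and r: "r \<in> hom C U X" "r' \<in> hom C V Y"
    and rs: "r \<cdot> s = idn C X" "r' \<cdot> s' = idn C Y"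
    and sq: "g \<cdot> s = s' \<cdot> f" "f \<cdot> r = r' \<cdot> g"
    using fg(3) unfolding is_retract_def homD(2,3)[OF f] homD(2,3)[OF g] by blast
  obtain x y f' where app: "fibrant_approx f x y f'" using ex_fibrant_approx[OF f] .
  obtain X' Y' where x: "x \<in> ancof C" "x \<in> hom C X X'" "fibrant C X'"
    and y: "y \<in> ancof C" "y \<in> hom C Y Y'" "fibrant C Y'"
    and f': "f' \<in> hom C X' Y'" "f' \<cdot> x = y \<cdot> f"
    using fibrant_approxE[OF app f] .
  obtain u v g' t t' where app_g: "fibrant_approx g u v g'"
    and t: "t \<in> hom C X' (tgt C u)" "t' \<in> hom C Y' (tgt C v)" "t \<cdot> x = u \<cdot> s" "t' \<cdot> y = v \<cdot> s'"
      "g' \<cdot> t = t' \<cdot> f'"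
    using fibrant_approx_push[OF f g s sq(1) app] homD(3)[OF x(2)] homD(3)[OF y(2)] by metis
  have g': "core_equiv g'" using equivs_iff[OF g app_g] fg(2) by blast
  obtain U' V' where u: "u \<in> ancof C" "u \<in> hom C U U'" "fibrant C U'"
    and v: "v \<in> ancof C" "v \<in> hom C V V'" "fibrant C V'"
    and g'_hom: "g' \<in> hom C U' V'" "g' \<cdot> u = v \<cdot> g"
    using fibrant_approxE[OF app_g g] .
  have uv [simp]: "tgt C u = U'" "tgt C v = V'" using homD(3)[OF u(2)] homD(3)[OF v(2)] .
  obtain x2 y2 f2 q q' where app2: "fibrant_approx f x2 y2 f2"
    and q: "q \<in> hom C U' (tgt C x2)" "q' \<in> hom C V' (tgt C y2)" "q \<cdot> u = x2 \<cdot> r" "q' \<cdot> v = y2 \<cdot> r'"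
      "f2 \<cdot> q = q' \<cdot> g'"
    using fibrant_approx_push[OF g f r sq(2) app_g] uv by metis
  obtain X2 Y2 where x2: "x2 \<in> ancof C" "x2 \<in> hom C X X2" "fibrant C X2"
    and y2: "y2 \<in> ancof C" "y2 \<in> hom C Y Y2" "fibrant C Y2"
    and f2: "f2 \<in> hom C X2 Y2" "f2 \<cdot> x2 = y2 \<cdot> f"
    using fibrant_approxE[OF app2 f] .
  have tq: "t \<in> hom C X' U'" "t' \<in> hom C Y' V'" "q \<in> hom C U' X2" "q' \<in> hom C V' Y2"
    using t(1,2) q(1,2) homD(3)[OF x2(2)] homD(3)[OF y2(2)] by simp_all
  note [simp] = homD[OF f] homD[OF s(1)] homD[OF s(2)] homD[OF r(1)] homD[OF r(2)] homD[OF x(2)]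
    homD[OF y(2)] homD[OF u(2)] homD[OF v(2)] homD[OF x2(2)] homD[OF y2(2)] homD[OF tq(1)]
    homD[OF tq(2)] homD[OF tq(3)] homD[OF tq(4)]
  \<comment> \<open>a map between two fibrant replacements of one object is a replacement of its identity\<close>
  have core_idn: "core_equiv k"
    if "j \<in> ancof C" "j \<in> hom C D D'" "fibrant C D'" "l \<in> ancof C" "l \<in> hom C D D''" "fibrant C D''"
      "k \<in> hom C D' D''" "k \<cdot> j = l" for j k l D D' D''
  proof -
    note D = homD(4)[OF that(2)]
    note [simp] = homD[OF that(2)] homD[OF that(5)]
    have "fibrant_approx (idn C D) j l k"
      by (rule fibrant_approxI[OF idn_hom[OF D] that(1-7)]) (simp add: that(8))
    then show ?thesis
      using equivs_iff[OF idn_hom[OF D]] ancof_equivs[OF wfs_left_idn[OF ancof_fib D]] by blast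
  qed
  have "core_equiv (q \<cdot> t)"
    by (rule core_idn[OF x x2 cmp_hom[OF tq(1,3)]]) (simp add: t(3) whisker[OF q(3)] rs(1))
  moreover have "core_equiv (q' \<cdot> t')"
    by (rule core_idn[OF y y2 cmp_hom[OF tq(2,4)]]) (simp add: t(4) whisker[OF q(4)] rs(2))
  ultimately have "core_equiv f'"
    using core_equiv_retract_up_to_equiv[OF f'(1) g' g'_hom(1) f2(1) tq t(5) q(5)] by blast
  then show "f \<in> equivs" using equivs_iff[OF f app] by blast
qed

text \<open>Pushing a fibrant replacement of the source forward along \<open>i\<close> replaces \<open>i\<close> by a cofibration \<open>t\<close>
  between fibrant objects, and lifting problems against core fibrations extend to \<open>t\<close>. Since \<open>t\<close> is
  a core equivalence, the fibration in its factorization is anodyne, so the retract argument makes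
  \<open>t\<close> itself an anodyne cofibration.\<close>

lemma cof_equivs_lift:
  assumes i: "i \<in> cof C" "i \<in> equivs" and p: "p \<in> fib C" "p \<in> hom C E F" "fibrant C F"
  shows "has_lift C i p"
proof -
  obtain A B where i_hom: "i \<in> hom C A B" using i(1) cof_arr arr_hom by blast
  obtain x A' where x: "x \<in> ancof C" "x \<in> hom C A A'" "fibrant C A'"
    using fibrant_replacement[OF homD(4)[OF i_hom]] by metis
  obtain B' y t where y: "y \<in> ancof C" "y \<in> hom C B B'" "fibrant C B'"
    and t: "t \<in> hom C A' B'" "t \<cdot> x = y \<cdot> i" "t \<in> cof C"
    and ext: "\<And>V \<alpha> \<beta>. \<lbrakk>fibrant C V; \<alpha> \<in> hom C A' V; \<beta> \<in> hom C B V; \<alpha> \<cdot> x = \<beta> \<cdot> i\<rbrakk>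
      \<Longrightarrow> \<exists>\<gamma>\<in>hom C B' V. \<gamma> \<cdot> t = \<alpha> \<and> \<gamma> \<cdot> y = \<beta>"
    using replacement_along[OF x(1,2) i_hom] i(1) by metis
  have t_eq: "core_equiv t"
    using equivs_iff[OF i_hom fibrant_approxI[OF i_hom x y t(1,2)]] i(2) by blast
  obtain k q M where k: "k \<in> ancof C" "k \<in> hom C A' M" and q: "q \<in> fib C" "q \<in> hom C M B'"
    and qk: "q \<cdot> k = t"
    using wfs_factor[OF ancof_fib t(1)] by metis
  have "core_equiv q"
    using core_equiv_cancel_right[OF core_equiv_ancof[OF k x(3) fibrant_src[OF q y(3)]] k(2) q(2)] t_eq
    by (simp add: qk)
  then have "q \<in> anfib C" using core_equiv_fib_anfib[OF _ q] by blast
  then have "is_retract C t k"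
    using retract_of_left_factor[OF k(2) q(2)] cof_lift[OF t(3)] by (simp add: qk)
  then have t_lift: "has_lift C t p"
    using ancof_lift[OF wfs_left_retract[OF ancof_fib homD(1)[OF t(1)] k(1)] p(1)] by blast
  show ?thesis
  proof (rule has_liftI[OF i_hom p(2)])
    fix u v
    assume u: "u \<in> hom C A E" and v: "v \<in> hom C B F" and eq: "p \<cdot> u = v \<cdot> i"
    obtain u' where u': "u' \<in> hom C A' E" "u' \<cdot> x = u"
      using fibrant_extension[OF fibrant_src[OF p] ancof_acyclic_cof[OF x(1)] x(2) u] .
    note [simp] = homD[OF i_hom] homD[OF x(2)] homD[OF y(2)] homD[OF t(1)] homD[OF p(2)] homD[OF u'(1)]
    have "(p \<cdot> u') \<cdot> x = v \<cdot> i" by (simp add: u'(2) eq)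
    then obtain \<gamma> where \<gamma>: "\<gamma> \<in> hom C B' F" "\<gamma> \<cdot> t = p \<cdot> u'" "\<gamma> \<cdot> y = v"
      using ext[OF p(3) cmp_hom[OF u'(1) p(2)] v] by blast
    obtain h where h: "h \<in> hom C B' E" "h \<cdot> t = u'" "p \<cdot> h = \<gamma>"
      using has_liftE[OF t_lift t(1) p(2) u'(1) \<gamma>(1) \<gamma>(2)[symmetric]] .
    note [simp] = homD[OF h(1)]
    have "(h \<cdot> y) \<cdot> i = u" using whisker[OF h(2), of x] by (simp add: t(2) u'(2))
    moreover have "p \<cdot> (h \<cdot> y) = v" by (simp add: whisker[OF h(3)] \<gamma>(3))
    ultimately show "\<exists>h\<in>hom C B E. h \<cdot> i = u \<and> p \<cdot> h = v"
      by (intro bexI[of _ "h \<cdot> y"]) (simp_all add: homI)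
  qed
qed

lemma equivs_arr: "equivs \<subseteq> arr C"
  by (auto simp: equivs_def)

theorem fresse_equivs:
  assumes "complete_cat U C" "cocomplete_cat U C"
  shows "fresse_right_semi_model U C equivs (cof C) (fib C)"
  unfolding fresse_right_semi_model_def
proof (intro conjI)
  show "\<forall>f\<in>arr C. fibrant C (tgt C f) \<longrightarrow>
      (\<exists>i\<in>cof C. \<exists>p\<in>fib C \<inter> equivs. tgt C i = src C p \<and> p \<cdot> i = f) \<and>
      (\<exists>i\<in>cof C \<inter> equivs. \<exists>p\<in>fib C. tgt C i = src C p \<and> p \<cdot> i = f)"
  proof (intro ballI impI)
    fix f
    assume f: "f \<in> arr C" "fibrant C (tgt C f)"
    obtain i p M where 1: "i \<in> cof C" "p \<in> anfib C" "i \<in> hom C (src C f) M" "p \<in> hom C M (tgt C f)"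
      "p \<cdot> i = f"
      using wfs_factor[OF cof_anfib arr_hom[OF f(1)]] .
    obtain j q N where 2: "j \<in> ancof C" "q \<in> fib C" "j \<in> hom C (src C f) N" "q \<in> hom C N (tgt C f)"
      "q \<cdot> j = f"
      using wfs_factor[OF ancof_fib arr_hom[OF f(1)]] .
    have "p \<in> fib C \<inter> equivs" "j \<in> cof C \<inter> equivs"
      using anfib_fib[OF 1(2)] anfib_equivs[OF 1(2,4) f(2)] ancof_cof[OF 2(1)] ancof_equivs[OF 2(1)]
      by blast+
    moreover have "tgt C i = src C p" "tgt C j = src C q"
      using homD[OF 1(3)] homD[OF 1(4)] homD[OF 2(3)] homD[OF 2(4)] by simp_all
    ultimately show "(\<exists>i\<in>cof C. \<exists>p\<in>fib C \<inter> equivs. tgt C i = src C p \<and> p \<cdot> i = f) \<and>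
      (\<exists>i\<in>cof C \<inter> equivs. \<exists>p\<in>fib C. tgt C i = src C p \<and> p \<cdot> i = f)"
      using 1(1,5) 2(2,5) by blast
  qed
  show "\<forall>i\<in>cof C. \<forall>p\<in>fib C. fibrant C (tgt C p) \<and> (i \<in> equivs \<or> p \<in> equivs) \<longrightarrow> has_lift C i p"
    using cof_equivs_lift cof_lift fib_equivs_anfib arr_hom fib_arr by blast
  show "retract_stable C (cof C)" "retract_stable C (fib C)"
    unfolding retract_stable_def
    using wfs_left_retract[OF cof_anfib] wfs_right_retract[OF ancof_fib] by blast+
  show "pushout_stable C (cof C)"
    unfolding pushout_stable_def using wfs_left_pushout[OF cof_anfib] by blast
qed (use assms cof_arr fib_arr terminal_fibrant in
    \<open>auto simp: two_out_of_three_equivs retract_stable_equivs equivs_arr category_axioms\<close>)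

end

section \<open>Consequences of a Fresse right semi-model structure\<close>

locale fresse_premodel = premodel_cat C
  for C :: "('o, 'm) premodel" (structure) and U :: "'u itself" and W :: "'m set" +
  assumes fresse: "fresse_right_semi_model U C W (cof C) (fib C)"
begin

lemma equiv_cmp: "\<lbrakk>f \<in> W; g \<in> W; f \<in> hom C A B; g \<in> hom C B D\<rbrakk> \<Longrightarrow> g \<cdot> f \<in> W"
  and equiv_cancel_right: "\<lbrakk>f \<in> W; g \<cdot> f \<in> W; f \<in> hom C A B; g \<in> hom C B D\<rbrakk> \<Longrightarrow> g \<in> W"
  and equiv_cancel_left: "\<lbrakk>g \<in> W; g \<cdot> f \<in> W; f \<in> hom C A B; g \<in> hom C B D\<rbrakk> \<Longrightarrow> f \<in> W"
  using fresse homD unfolding fresse_right_semi_model_def two_out_of_three_def by metis+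

lemma equiv_retract: "\<lbrakk>f \<in> arr C; g \<in> W; is_retract C f g\<rbrakk> \<Longrightarrow> f \<in> W"
  using fresse unfolding fresse_right_semi_model_def retract_stable_def by blast

lemma equiv_arr: "f \<in> W \<Longrightarrow> f \<in> arr C"
  using fresse unfolding fresse_right_semi_model_def by blast

lemma factor_hom:
  assumes "i \<in> arr C" "p \<in> arr C" "tgt C i = src C p" "p \<cdot> i = f" "f \<in> hom C A B"
  shows "i \<in> hom C A (src C p)" "p \<in> hom C (src C p) B"
  using assms homD[OF assms(5)] by (auto intro: homI)

lemma factor_cof_trivial_fib:
  assumes "f \<in> hom C A B" "fibrant C B"
  obtains i p M where "i \<in> cof C" "p \<in> fib C" "p \<in> W" "i \<in> hom C A M" "p \<in> hom C M B" "p \<cdot> i = f"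
proof -
  have "fibrant C (tgt C f)" using assms homD(3) by simp
  then obtain i p where ip: "i \<in> cof C" "p \<in> fib C" "p \<in> W" "tgt C i = src C p" "p \<cdot> i = f"
    using fresse homD(1)[OF assms(1)] unfolding fresse_right_semi_model_def by blast
  from factor_hom[OF cof_arr[OF ip(1)] fib_arr[OF ip(2)] ip(4,5) assms(1)] show ?thesis
    using that ip by blast
qed

lemma factor_trivial_cof_fib:
  assumes "f \<in> hom C A B" "fibrant C B"
  obtains i p M where "i \<in> cof C" "i \<in> W" "p \<in> fib C" "i \<in> hom C A M" "p \<in> hom C M B" "p \<cdot> i = f"
proof -
  have "fibrant C (tgt C f)" using assms homD(3) by simp
  then obtain i p where ip: "i \<in> cof C" "i \<in> W" "p \<in> fib C" "tgt C i = src C p" "p \<cdot> i = f"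
    using fresse homD(1)[OF assms(1)] unfolding fresse_right_semi_model_def by blast
  from factor_hom[OF cof_arr[OF ip(1)] fib_arr[OF ip(3)] ip(4,5) assms(1)] show ?thesis
    using that ip by blast
qed

lemma core_lift:
  assumes "i \<in> cof C" "p \<in> fib C" "p \<in> hom C X Y" "fibrant C Y" "i \<in> W \<or> p \<in> W"
  shows "has_lift C i p"
  using fresse assms homD(3)[OF assms(3)] unfolding fresse_right_semi_model_def by blast

lemma core_fib_equiv_iff:
  assumes p: "p \<in> fib C" "p \<in> hom C X Y" and Y: "fibrant C Y"
  shows "p \<in> W \<longleftrightarrow> p \<in> anfib C"
proof
  assume "p \<in> W"
  then show "p \<in> anfib C"
    using core_lift[OF _ p Y] wfs_rightI[OF cof_anfib fib_arr[OF p(1)]] by blast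
next
  assume "p \<in> anfib C"
  obtain i q M where f: "i \<in> cof C" "q \<in> fib C" "q \<in> W" "i \<in> hom C X M" "q \<in> hom C M Y" "q \<cdot> i = p"
    using factor_cof_trivial_fib[OF p(2) Y] .
  have "is_retract C p q"
    using retract_of_right_factor[OF f(4,5)] cof_lift[OF f(1) \<open>p \<in> anfib C\<close>] by (simp add: f(6))
  then show "p \<in> W" using equiv_retract fib_arr[OF p(1)] f(3) by blast
qed

lemma core_acyclic_cof_equiv:
  assumes i: "i \<in> acyclic_cof C" "i \<in> hom C A B" and B: "fibrant C B"
  shows "i \<in> W"
proof -
  obtain j p M where f: "j \<in> cof C" "j \<in> W" "p \<in> fib C" "j \<in> hom C A M" "p \<in> hom C M B" "p \<cdot> j = i"
    using factor_trivial_cof_fib[OF i(2) B] .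
  have "is_retract C i j"
    using retract_of_left_factor[OF f(4,5)] acyclic_cof_lift[OF i(1) f(3,5) B] by (simp add: f(6))
  then show "i \<in> W" using equiv_retract homD(1)[OF i(2)] f(2) by blast
qed

text \<open>Over a fibrant target the retract argument applies directly, because lifts are available
  against core fibrations. In general, compose with a trivial cofibration to a fibrant object.\<close>

theorem cof_equiv_eq: "cof C \<inter> W = acyclic_cof C"
proof
  show sub: "cof C \<inter> W \<subseteq> acyclic_cof C"
    by (auto intro: acyclic_cofI core_lift)
  show "acyclic_cof C \<subseteq> cof C \<inter> W"
  proof
    fix i
    assume i: "i \<in> acyclic_cof C"
    then have i_hom: "i \<in> hom C (src C i) (tgt C i)" using acyclic_cof_cof cof_arr arr_hom by blast
    obtain T t where T: "is_terminal C T" and t: "t \<in> hom C (tgt C i) T"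
      using terminal homD(5)[OF i_hom] unfolding is_terminal_def by blast
    obtain j p M where f: "j \<in> cof C" "j \<in> W" "p \<in> fib C" "j \<in> hom C (tgt C i) M" "p \<in> hom C M T"
      using factor_trivial_cof_fib[OF t terminal_fibrant[OF T]] by metis
    have "j \<cdot> i \<in> acyclic_cof C"
      using acyclic_cof_cmp[OF i _ i_hom f(4)] sub f(1,2) by blast
    then have "j \<cdot> i \<in> W"
      using core_acyclic_cof_equiv[OF _ cmp_hom[OF i_hom f(4)]
          fibrant_src[OF f(3,5) terminal_fibrant[OF T]]] by blast
    then show "i \<in> cof C \<inter> W"
      using equiv_cancel_left[OF f(2) _ i_hom f(4)] acyclic_cof_cof[OF i] by blast
  qed
qed

lemma ancof_equiv: "i \<in> ancof C \<Longrightarrow> i \<in> W"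
  using ancof_acyclic_cof cof_equiv_eq by blast

lemma idn_equiv: "X \<in> obj C \<Longrightarrow> idn C X \<in> W"
  using ancof_equiv wfs_left_idn[OF ancof_fib] by blast

text \<open>An acyclic fibration \<open>p\<close> lifts only against cofibrations between cofibrant objects. After
  precomposition with a cofibrant replacement \<open>\<pi>\<close> of its source, the cofibration in a factorization
  of \<open>p \<cdot> \<pi>\<close> is of this kind, so the retract argument applies to \<open>p \<cdot> \<pi>\<close>.\<close>

theorem core_right_saturated: "core_right_saturated C"
  unfolding core_right_saturated_def
proof (intro ballI impI)
  fix p
  assume p: "p \<in> acyclic_fib C" and Y: "fibrant C (tgt C p)"
  define X Y where "X = src C p" and "Y = tgt C p"
  have p_hom: "p \<in> hom C X Y" and Yf: "fibrant C Y"
    using arr_hom[OF fib_arr[OF acyclic_fib_fib[OF p]]] Y by (simp_all add: X_def Y_def)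
  note p_fib = acyclic_fib_fib[OF p]
  note Xf = fibrant_src[OF p_fib p_hom Yf]
  obtain X' \<pi> where \<pi>: "\<pi> \<in> anfib C" "\<pi> \<in> hom C X' X" and X': "cofibrant C X'"
    using cofibrant_replacement[OF fibrant_obj[OF Xf]] by metis
  obtain i q M where f: "i \<in> cof C" "q \<in> fib C" "q \<in> W" "i \<in> hom C X' M" "q \<in> hom C M Y" "q \<cdot> i = p \<cdot> \<pi>"
    using factor_cof_trivial_fib[OF cmp_hom[OF \<pi>(2) p_hom] Yf] .
  have "has_lift C i (p \<cdot> \<pi>)"
    using has_lift_cmp_right[OF cof_lift[OF f(1) \<pi>(1)] acyclic_fib_lift[OF p f(1,4) X'] \<pi>(2) p_hom
        cof_arr[OF f(1)]] .
  then have "is_retract C (p \<cdot> \<pi>) q" using retract_of_right_factor[OF f(4,5)] by (simp add: f(6))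
  then have "p \<cdot> \<pi> \<in> W"
    using equiv_retract[OF homD(1)[OF cmp_hom[OF \<pi>(2) p_hom]] f(3)] by blast
  moreover have "\<pi> \<in> W" using core_fib_equiv_iff[OF anfib_fib[OF \<pi>(1)] \<pi>(2) Xf] \<pi>(1) by blast
  ultimately have "p \<in> W" using equiv_cancel_right \<pi>(2) p_hom by blast
  then show "p \<in> anfib C" using core_fib_equiv_iff[OF p_fib p_hom Yf] by blast
qed

text \<open>Factor the codiagonal into a cofibration and a trivial fibration. Each end of the resulting
  cylinder is a section of that trivial fibration, hence an equivalence.\<close>

lemma relative_strong_cylinder:
  assumes f: "f \<in> cof C" "fibrant C (tgt C f)"
  shows "has_relative_strong_cylinder C f"
proof -
  note fh = arr_hom[OF cof_arr[OF f(1)]]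
  note X = homD(5)[OF fh]
  obtain Q i0 i1 where Q: "is_pushout C f f Q i0 i1" using pushouts[OF fh fh] by blast
  note po = pushoutD[OF Q fh fh]
  obtain d where d: "d \<in> hom C Q (tgt C f)" "d \<cdot> i0 = idn C (tgt C f)" "d \<cdot> i1 = idn C (tgt C f)"
    using pushout_univ[OF Q fh fh idn_hom[OF X] idn_hom[OF X]] by blast
  obtain j q I where jq: "j \<in> cof C" "q \<in> fib C" "q \<in> W" "j \<in> hom C Q I" "q \<in> hom C I (tgt C f)" "q \<cdot> j = d"
    using factor_cof_trivial_fib[OF d(1) f(2)] .
  note ji = cmp_hom[OF po(1) jq(4)]
  note [simp] = homD[OF po(1)] homD[OF jq(4)] homD[OF jq(5)]
  have "q \<cdot> (j \<cdot> i0) = idn C (tgt C f)" by (simp add: whisker[OF jq(6)] d(2))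
  then have "j \<cdot> i0 \<in> W" using equiv_cancel_left[OF jq(3) _ ji jq(5)] idn_equiv[OF X] by simp
  moreover have "j \<cdot> i0 \<in> cof C"
    using cof_cmp[OF wfs_left_pushout[OF cof_anfib f(1) is_pushout_commute[OF Q]] jq(1) po(1) jq(4)] .
  ultimately have "j \<cdot> i0 \<in> acyclic_cof C" using cof_equiv_eq by blast
  then show ?thesis unfolding has_relative_strong_cylinder_def
    using Q d jq(1,4,5,6) by blast
qed

text \<open>Factor the diagonal into a trivial cofibration and a fibration, which is possible because the
  pullback is fibrant. The first projection has the trivial cofibration as a section, hence is an
  equivalence, and core fibrations that are equivalences are anodyne.\<close>

lemma relative_strong_path:
  assumes f: "f \<in> fib C" "fibrant C (tgt C f)"
  shows "has_relative_strong_path C f"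
proof -
  note fh = arr_hom[OF fib_arr[OF f(1)]]
  note X = homD(4)[OF fh]
  note Xf = fibrant_src[OF f(1) fh f(2)]
  obtain Q p0 p1 where Q: "is_pullback C f f Q p0 p1" using pullbacks[OF fh fh] by blast
  note pb = pullbackD[OF Q fh fh]
  obtain d where d: "d \<in> hom C (src C f) Q" "p0 \<cdot> d = idn C (src C f)" "p1 \<cdot> d = idn C (src C f)"
    using pullback_univ[OF Q fh fh idn_hom[OF X] idn_hom[OF X]] by blast
  obtain s e P where se: "s \<in> cof C" "s \<in> W" "e \<in> fib C" "s \<in> hom C (src C f) P" "e \<in> hom C P Q" "e \<cdot> s = d"
    using factor_trivial_cof_fib[OF d(1) pullback_fibrant[OF Q f(1) fh Xf]] .
  note pe = cmp_hom[OF se(5) pb(1)]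
  note [simp] = homD[OF pb(1)] homD[OF se(4)] homD[OF se(5)]
  have "p0 \<cdot> e \<cdot> s = idn C (src C f)" by (simp add: se(6) d(2))
  then have "p0 \<cdot> e \<in> W" using equiv_cancel_right[OF se(2) _ se(4) pe] idn_equiv[OF X] by simp
  moreover have "p0 \<cdot> e \<in> fib C"
    using fib_cmp[OF se(3) wfs_right_pullback[OF ancof_fib f(1) is_pullback_commute[OF Q]] se(5) pb(1)] .
  ultimately have "p0 \<cdot> e \<in> acyclic_fib C"
    using core_fib_equiv_iff[OF _ pe Xf] anfib_acyclic_fib by blast
  then show ?thesis unfolding has_relative_strong_path_def
    using Q d se(3-6) by blast
qed

lemma strong_path:
  assumes "fibrant C X"
  shows "has_strong_path C X"
proof -
  obtain T t where T: "is_terminal C T" and t: "t \<in> hom C X T" "t \<in> fib C"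
    using assms unfolding fibrant_wrt_def by blast
  have "fibrant C (tgt C t)" using terminal_fibrant[OF T] homD(3)[OF t(1)] by simp
  then show ?thesis
    using relative_strong_path[OF t(2)] has_strong_path_iff_relative[OF T t(1)] by blast
qed

text \<open>The right-hand side does not mention \<open>W\<close>, which is why there is at most one class of
  equivalences.\<close>

theorem equiv_characterization:
  assumes f: "f \<in> hom C X Y"
  shows "f \<in> W \<longleftrightarrow> (\<exists>y Y' i p M. y \<in> ancof C \<and> y \<in> hom C Y Y' \<and> fibrant C Y' \<and>
    i \<in> ancof C \<and> i \<in> hom C X M \<and> p \<in> anfib C \<and> p \<in> hom C M Y' \<and> p \<cdot> i = y \<cdot> f)"
proof
  assume W: "f \<in> W"
  obtain y Y' where y: "y \<in> ancof C" "y \<in> hom C Y Y'" "fibrant C Y'"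
    using fibrant_replacement[OF homD(5)[OF f]] by metis
  note yf = cmp_hom[OF f y(2)]
  obtain i p M where ip: "i \<in> ancof C" "p \<in> fib C" "i \<in> hom C X M" "p \<in> hom C M Y'" "p \<cdot> i = y \<cdot> f"
    using wfs_factor[OF ancof_fib yf] .
  have "y \<cdot> f \<in> W" using equiv_cmp[OF W ancof_equiv[OF y(1)] f y(2)] .
  then have "p \<in> W" using equiv_cancel_right[OF ancof_equiv[OF ip(1)] _ ip(3,4)] by (simp add: ip(5))
  then have "p \<in> anfib C" using core_fib_equiv_iff[OF ip(2,4) y(3)] by blast
  then show "\<exists>y Y' i p M. y \<in> ancof C \<and> y \<in> hom C Y Y' \<and> fibrant C Y' \<and>
    i \<in> ancof C \<and> i \<in> hom C X M \<and> p \<in> anfib C \<and> p \<in> hom C M Y' \<and> p \<cdot> i = y \<cdot> f"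
    using y ip by blast
next
  assume "\<exists>y Y' i p M. y \<in> ancof C \<and> y \<in> hom C Y Y' \<and> fibrant C Y' \<and>
    i \<in> ancof C \<and> i \<in> hom C X M \<and> p \<in> anfib C \<and> p \<in> hom C M Y' \<and> p \<cdot> i = y \<cdot> f"
  then obtain y Y' i p M where y: "y \<in> ancof C" "y \<in> hom C Y Y'" "fibrant C Y'"
    and ip: "i \<in> ancof C" "i \<in> hom C X M" "p \<in> anfib C" "p \<in> hom C M Y'" "p \<cdot> i = y \<cdot> f" by blast
  have "p \<in> W" using core_fib_equiv_iff[OF anfib_fib[OF ip(3)] ip(4) y(3)] ip(3) by blast
  then have "y \<cdot> f \<in> W" using equiv_cmp[OF ancof_equiv[OF ip(1)] _ ip(2,4)] by (simp add: ip(5))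
  then show "f \<in> W" using equiv_cancel_left[OF ancof_equiv[OF y(1)] _ f y(2)] by blast
qed

theorem spitzweck_iff_left_saturated:
  "spitzweck_right_semi_model U C W (cof C) (fib C) \<longleftrightarrow> left_saturated C"
proof
  assume "spitzweck_right_semi_model U C W (cof C) (fib C)"
  then have "weak_factorization_system C (acyclic_cof C) (fib C)"
    by (simp add: spitzweck_right_semi_model_def cof_equiv_eq)
  then have "acyclic_cof C = ancof C"
    using ancof_fib unfolding weak_factorization_system_def by blast
  then show "left_saturated C" by (simp add: left_saturated_def)
next
  assume "left_saturated C"
  then have "acyclic_cof C = ancof C" using ancof_acyclic_cof unfolding left_saturated_def by blast
  then show "spitzweck_right_semi_model U C W (cof C) (fib C)"
    using fresse ancof_fib by (simp add: spitzweck_right_semi_model_def cof_equiv_eq)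
qed

end

lemma fresse_unique:
  assumes "premodel_cat C" "fresse_right_semi_model U C W (cof C) (fib C)"
    "fresse_right_semi_model U C W' (cof C) (fib C)"
  shows "W = W'"
proof -
  interpret W: fresse_premodel C U W using assms by (simp add: fresse_premodel_def fresse_premodel_axioms_def)
  interpret W': fresse_premodel C U W' using assms by (simp add: fresse_premodel_def fresse_premodel_axioms_def)
  have "f \<in> W \<longleftrightarrow> f \<in> W'" if "f \<in> arr C" for f
    unfolding W.equiv_characterization[OF W.arr_hom[OF that]]
      W'.equiv_characterization[OF W.arr_hom[OF that]] ..
  then show ?thesis using W.equiv_arr W'.equiv_arr by blast
qed

section \<open>The characterization\<close>

theorem theorem3p8:
  fixes C :: "('o, 'm) premodel"
  assumes universe: "infinite (UNIV :: 'u set)"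
    and premodel: "premodel_category TYPE('u) C"
  shows
    "((\<exists>W. fresse_right_semi_model TYPE('u) C W (cof C) (fib C)) \<longleftrightarrow>
        weak_model_category TYPE('u) C \<and>
        (\<forall>X\<in>obj C. fibrant C X \<longrightarrow> has_strong_path C X) \<and>
        core_right_saturated C) \<and>
     (weak_model_category TYPE('u) C \<and>
        (\<forall>X\<in>obj C. fibrant C X \<longrightarrow> has_strong_path C X) \<and>
        core_right_saturated C \<longrightarrow>
        (\<exists>!W. fresse_right_semi_model TYPE('u) C W (cof C) (fib C)) \<and>
        (\<forall>W. fresse_right_semi_model TYPE('u) C W (cof C) (fib C) \<longrightarrow>
          (spitzweck_right_semi_model TYPE('u) C W (cof C) (fib C) \<longleftrightarrow> left_saturated C)))"
    (is "((\<exists>W. ?fresse W) \<longleftrightarrow> ?conditions) \<and> (_ \<longrightarrow> _ \<and> (\<forall>W. _ \<longrightarrow> (?spitzweck W \<longleftrightarrow> _)))")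
proof -
  interpret premodel_cat C using premodel_catI[OF universe premodel] .
  have loc: "fresse_premodel C TYPE('u) W" if "?fresse W" for W
    using that by unfold_locales
  have necessary: ?conditions if "?fresse W" for W
  proof -
    interpret fresse_premodel C "TYPE('u)" W using loc[OF that] .
    show ?thesis
      using premodel relative_strong_cylinder relative_strong_path strong_path core_right_saturated
      by (simp add: weak_model_category_def)
  qed
  have sufficient: "\<exists>W. ?fresse W" if c: ?conditions
  proof -
    interpret core_saturated_premodel C
    proof unfold_locales
      show "has_strong_path C X" if "fibrant C X" for X
        using c fibrant_obj[OF that] that by blast
      show "p \<in> anfib C" if "p \<in> acyclic_fib C" "p \<in> hom C X Y" "fibrant C Y" for p X Y
        using c that homD(3)[OF that(2)] unfolding core_right_saturated_def by blast
    qed (use c in \<open>simp_all add: weak_model_category_def\<close>)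
    show ?thesis using fresse_equivs premodel unfolding premodel_category_def by blast
  qed
  have "\<exists>!W. ?fresse W" if ?conditions
    using sufficient[OF that] fresse_unique[OF premodel_cat_axioms] by blast
  moreover have "?spitzweck W \<longleftrightarrow> left_saturated C" if "?fresse W" for W
    using fresse_premodel.spitzweck_iff_left_saturated[OF loc[OF that]] .
  ultimately show ?thesis using necessary sufficient by blast
qed

end
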